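(* Let $s_0=\sigma_0+it_0\in\mathbb{C}$ with $\sigma_0>1$, and let $\sigma$ be fixed with $\frac12<\sigma\le1$ and $\sigma_0+\sigma>2$. For $s=\sigma+it$ with $t\ge2$, $$\int_{2}^{T}|\zeta_2(s_0,\sigma+it)|^2\,dt=\zeta_2^{[2]}(s_0,2\sigma)\,T+O\big(T^{2-2\sigma}\log T\big)+O\big(T^{1/2}\big)\qquad(T\to\infty).$$
   Context: The Euler double zeta-function is $$\zeta_2(s_1,s_2)=\sum_{m=1}^\infty\frac{1}{m^{s_1}}\sum_{n=1}^\infty\frac{1}{(m+n)^{s_2}}=\sum_{k=2}^\infty\Big(\sum_{m=1}^{k-1}\frac{1}{m^{s_1}}\Big)\frac{1}{k^{s_2}},$$ absolutely convergent for $\Re s_2>1$, $\Re(s_1+s_2)>2$, and continued meromorphically to $\mathbb{C}^2$ (singularities on $s_2=1$ and $s_1+s_2=2,1,0,-2,-4,\dots$). Also $$\zeta_2^{[2]}(s_1,s_2)=\sum_{k=2}^\infty\Big|\sum_{m=1}^{k-1}\frac{1}{m^{s_1}}\Big|^2\frac{1}{k^{s_2}},$$ convergent when $\Re s_1\ge1,\Re s_2>1$, or when $\Re s_1<1$ and $2\Re s_1+\Re s_2>3$. Implied constants may depend on $s_0$ and $\sigma$. *)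

theory Defs
  imports "HOL-Complex_Analysis.Complex_Analysis" "HOL-Library.Landau_Symbols"
begin

definition double_zeta_series :: "complex \<Rightarrow> complex \<Rightarrow> complex" where
  "double_zeta_series s1 s2 =
     (\<Sum>m. 1 / of_nat (Suc m) powr s1 * (\<Sum>n. 1 / of_nat (Suc m + Suc n) powr s2))"

definition double_zeta_halfspace :: "(complex \<times> complex) set" where
  "double_zeta_halfspace = {(s1, s2). Re s2 > 1 \<and> Re (s1 + s2) > 2}"

definition double_zeta_sing :: "(complex \<times> complex) set" where
  "double_zeta_sing =
     {(s1, s2). s2 = 1 \<or> s1 + s2 = 2 \<or> s1 + s2 = 1 \<or> (\<exists>k::nat. s1 + s2 = - 2 * of_nat k)}"

text \<open>Holomorphy in two variables: continuous, and holomorphic in each variable separately.\<close>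

definition holomorphic2_on :: "(complex \<Rightarrow> complex \<Rightarrow> complex) \<Rightarrow> (complex \<times> complex) set \<Rightarrow> bool" where
  "holomorphic2_on F U \<longleftrightarrow> open U \<and> continuous_on U (\<lambda>(s1, s2). F s1 s2) \<and>
     (\<forall>s1. (\<lambda>s2. F s1 s2) holomorphic_on {s2. (s1, s2) \<in> U}) \<and>
     (\<forall>s2. (\<lambda>s1. F s1 s2) holomorphic_on {s1. (s1, s2) \<in> U})"

definition double_zeta_continuation ::
    "(complex \<times> complex) set \<Rightarrow> (complex \<Rightarrow> complex \<Rightarrow> complex) \<Rightarrow> bool" where
  "double_zeta_continuation U F \<longleftrightarrow>
     open U \<and> convex U \<and> double_zeta_halfspace \<subseteq> U \<and>
     holomorphic2_on F (U - double_zeta_sing) \<and>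
     (\<forall>(s1, s2) \<in> double_zeta_halfspace. F s1 s2 = double_zeta_series s1 s2)"

text \<open>
  The Euler double zeta function off its singular hyperplanes. The classical continuation to the
  whole space is the case \<^term>\<open>U = UNIV\<close>; by the identity theorem every admissible \<open>U\<close> yields
  the same value (\<open>euler_double_zeta_eqI\<close> below), so admitting smaller domains changes nothing.
  The value at points of \<^const>\<open>double_zeta_sing\<close> is unspecified.
\<close>

definition euler_double_zeta :: "complex \<Rightarrow> complex \<Rightarrow> complex" where
  "euler_double_zeta s1 s2 =
     (THE w. \<exists>U F. double_zeta_continuation U F \<and> (s1, s2) \<in> U - double_zeta_sing \<and> w = F s1 s2)"

definition double_zeta_sq :: "complex \<Rightarrow> complex \<Rightarrow> complex" where
  "double_zeta_sq s1 s2 =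
     (\<Sum>j. let k = j + 2 in
        of_real ((cmod (\<Sum>m = 1..k - 1. 1 / of_nat m powr s1))\<^sup>2) * (1 / of_nat k powr s2))"

lemma double_zeta_sing_slice:
  defines "S \<equiv> \<lambda>s1. {s2. (s1, s2) \<in> double_zeta_sing}"
  shows "countable (S s1)" "closed (S s1)"
proof -
  define A where "A = range (\<lambda>k::nat. - 2 * of_nat k - s1)"
  have S: "S s1 = {1, 2 - s1, 1 - s1} \<union> A"
    unfolding S_def double_zeta_sing_def A_def
    by (auto simp: algebra_simps add_eq_0_iff2 eq_diff_eq image_iff)
  show "countable (S s1)" unfolding S A_def by simp
  have "closed A"
  proof (rule discrete_imp_closed[of 1])
    show "\<forall>x\<in>A. \<forall>y\<in>A. dist y x < 1 \<longrightarrow> y = x"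
    proof (intro ballI impI)
      fix x y assume "x \<in> A" "y \<in> A" and d: "dist y x < 1"
      then obtain j k :: nat where jk: "x = - 2 * of_nat j - s1" "y = - 2 * of_nat k - s1"
        unfolding A_def by auto
      have "y - x = of_real (2 * (real j - real k))" by (simp add: jk)
      then have "cmod (y - x) = \<bar>2 * (real j - real k)\<bar>" by (metis norm_of_real real_norm_def)
      with d have "\<bar>2 * (real j - real k)\<bar> < 1" by (simp add: dist_norm)
      then have "real j < real k + 1" "real k < real j + 1" by (auto simp: abs_less_iff)
      then have "j = k" by linarith
      then show "y = x" by (simp add: jk)
    qed
  qed simp
  then show "closed (S s1)" unfolding S by (intro closed_Un) auto
qed

lemma double_zeta_continuation_unique:
  assumes F: "double_zeta_continuation U F" and G: "double_zeta_continuation V G"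
    and p: "(s1, s2) \<in> U - double_zeta_sing" "(s1, s2) \<in> V"
  shows "F s1 s2 = G s1 s2"
proof -
  define W where "W = {z. (s1, z) \<in> U \<inter> V}"
  define S where "S = {z. (s1, z) \<in> double_zeta_sing}"
  define H where "H = {z. (s1, z) \<in> double_zeta_halfspace}"
  have UV: "open (U \<inter> V)" "convex (U \<inter> V)" "double_zeta_halfspace \<subseteq> U \<inter> V"
    using F G by (auto simp: double_zeta_continuation_def convex_Int)
  have W: "W = Pair s1 -` (U \<inter> V)" by (auto simp: W_def)
  have oW: "open W" unfolding W by (intro open_vimage UV continuous_intros)
  have cW: "convex W"
  proof (rule convexI)
    fix x y and u v :: real
    assume xy: "x \<in> W" "y \<in> W" and uv: "0 \<le> u" "0 \<le> v" "u + v = 1"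
    have "u *\<^sub>R (s1, x) + v *\<^sub>R (s1, y) \<in> U \<inter> V"
      using convexD[OF UV(2), of "(s1, x)" "(s1, y)" u v] xy uv by (auto simp: W_def)
    moreover have "u *\<^sub>R s1 + v *\<^sub>R s1 = s1" by (metis uv(3) scaleR_add_left scaleR_one)
    ultimately show "u *\<^sub>R x + v *\<^sub>R y \<in> W" by (simp add: W_def)
  qed
  have S: "countable S" "closed S" using double_zeta_sing_slice[of s1] by (simp_all add: S_def)
  have con: "connected (W - S)"
    by (intro connected_open_diff_countable oW convex_connected cW S) simp
  have Heq: "H = {z. Re z > 1} \<inter> {z. Re z > 2 - Re s1}"
    by (auto simp: H_def double_zeta_halfspace_def)
  have oH: "open H" unfolding Heq by (intro open_Int open_halfspace_Re_gt)
  have "of_real (max 2 (3 - Re s1)) \<in> H" unfolding Heq by (auto simp: max_def)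
  then have neH: "H \<noteq> {}" by blast
  have disj: "double_zeta_halfspace \<inter> double_zeta_sing = {}"
    by (auto simp: double_zeta_halfspace_def double_zeta_sing_def complex_eq_iff)
  have HW: "H \<subseteq> W - S" using UV(3) disj by (auto simp: H_def W_def S_def)
  have hol: "F s1 holomorphic_on (W - S)" "G s1 holomorphic_on (W - S)"
    using F G unfolding double_zeta_continuation_def holomorphic2_on_def W_def S_def
    by (auto elim!: allE[of _ s1] intro: holomorphic_on_subset)
  have eq: "F s1 z = G s1 z" if "z \<in> H" for z
    using F G that unfolding double_zeta_continuation_def H_def by fastforce
  have "s2 \<in> W - S" using p by (auto simp: W_def S_def)
  then show ?thesis
    using analytic_continuation_open[OF oH _ neH con HW hol eq] oW S(2) by (simp add: open_Diff)
qed

lemma euler_double_zeta_eqI: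
  assumes "double_zeta_continuation U F" "(s1, s2) \<in> U - double_zeta_sing"
  shows "euler_double_zeta s1 s2 = F s1 s2"
  unfolding euler_double_zeta_def
proof (rule the_equality)
  fix w assume "\<exists>U F. double_zeta_continuation U F \<and> (s1, s2) \<in> U - double_zeta_sing \<and> w = F s1 s2"
  then show "w = F s1 s2" using double_zeta_continuation_unique assms by blast
qed (use assms in blast)

end

theory Submission imports Defs begin

text \<open>
  Write \<open>H m s\<close> for the continuation of the sum of \<open>n powr (- s)\<close> over \<open>n > m\<close>. The double zeta
  function is the sum of \<open>m powr (- s1) * H m s2\<close>, which converges normally for \<open>Re s2 > 0\<close>,
  \<open>Re (s1 + s2) > 2\<close> away from \<open>s2 = 1\<close>. For \<open>m \<ge> |s|\<close> one has \<open>H m s = O(m powr (1 - \<sigma>) / |s|)\<close>,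
  so for \<open>T / 2 \<le> t \<le> T\<close> the function differs from its Dirichlet polynomial of length about \<open>2 T\<close>
  by \<open>O(T powr (- \<sigma>))\<close>. Squaring out the polynomial, the diagonal gives the main term; the off-diagonal
  terms are controlled by \<open>1 / |ln (n / m)| \<le> max m n / |n - m|\<close> and contribute
  \<open>O(T powr (2 - 2 \<sigma>) ln T)\<close> if \<open>\<sigma> < 1\<close>. The cross term with the remainder, by the arithmetic-geometric
  mean inequality, is \<open>O(T powr (1 / 2))\<close>. Dyadic summation over \<open>T\<close> finishes the proof.
\<close>

subsection \<open>Power sums\<close>

text \<open>The obstacle is uniformity in t. The Euler-Maclaurin remainder |s| m powr (- \<sigma>)
  has size T powr (1 - \<sigma>) at m ~ T; its square, integrated over a block, gives T powr (3 - 2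
  \<sigma>), no smaller than the main term. Hence the extra work for a gain of 1 / |s| in the tails.
  That gain forces dyadic blocks: one cutoff must exceed |s| on the whole block, and |s| must stay
  comparable with T. The two error terms cross at \<sigma> = 3 / 4, where 2 - 2 \<sigma> = 1 / 2.
  Only the dominant one is ever proved and the other is set to 0. The bounding function then grows
  at least like the square root of T, so summing the blocks costs only a constant. At \<sigma> = 1
  this also avoids summing a bare ln T over about ln T blocks, and it leaves room to weaken the
  exponent below 1, where the bound for Dirichlet polynomials has a finite constant. The
  continuation to all of the plane squared is never built: by uniqueness, a convex domain containing
  the relevant vertical lines determines the same values.\<close>

lemma powr_tail_telescope:
  fixes x \<alpha> :: real
  assumes "x > 0" "\<alpha> > 0"
  shows "(x + 1) powr (- 1 - \<alpha>) \<le> (x powr (- \<alpha>) - (x + 1) powr (- \<alpha>)) / \<alpha>"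
proof -
  have "\<exists>z>x. z < x + 1 \<and> (x + 1) powr (- \<alpha>) - x powr (- \<alpha>) =
      ((x + 1) - x) * (- \<alpha> * z powr (- 1 - \<alpha>))"
    by (rule MVT2) (use assms in \<open>auto intro!: derivative_eq_intros simp: field_simps powr_diff powr_minus\<close>)
  then obtain z where z: "z > x" "z < x + 1"
    "(x + 1) powr (- \<alpha>) - x powr (- \<alpha>) = - \<alpha> * z powr (- 1 - \<alpha>)" by auto
  have "(x + 1) powr (- 1 - \<alpha>) \<le> z powr (- 1 - \<alpha>)"
    using z assms by (intro powr_mono2') auto
  then have "\<alpha> * (x + 1) powr (- 1 - \<alpha>) \<le> \<alpha> * z powr (- 1 - \<alpha>)"
    using assms by simp
  with z(3) have "\<alpha> * (x + 1) powr (- 1 - \<alpha>) \<le> x powr (- \<alpha>) - (x + 1) powr (- \<alpha>)" by linarith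
  then show ?thesis using assms by (simp add: pos_le_divide_eq mult.commute)
qed

lemma tendsto_powr_shift_0:
  fixes x :: real
  assumes "x < 0"
  shows "(\<lambda>n. real (k + n) powr x) \<longlonglongrightarrow> 0"
proof (rule tendsto_neg_powr[OF assms])
  show "filterlim (\<lambda>n. real (k + n)) at_top sequentially"
    by (rule filterlim_compose[OF filterlim_real_sequentially])
      (simp add: filterlim_add_const_nat_at_top add.commute)
qed

lemma powr_tail_sum:
  fixes \<alpha> :: real
  assumes "\<alpha> > 0" "k > 0"
  shows "summable (\<lambda>n. real (k + n) powr (- 1 - \<alpha>))"
    and "(\<Sum>n. real (k + n) powr (- 1 - \<alpha>)) \<le> (1 + 1 / \<alpha>) * real k powr (- \<alpha>)"
proof -
  define g where "g n = real (k + n) powr (- \<alpha>) / \<alpha>" for n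
  have "(\<lambda>n. real (k + n) powr (- \<alpha>)) \<longlonglongrightarrow> 0"
    using assms by (intro tendsto_powr_shift_0) auto
  then have "g \<longlonglongrightarrow> 0" unfolding g_def using tendsto_divide_zero by blast
  then have gs: "(\<lambda>n. g n - g (Suc n)) sums (g 0 - 0)" by (rule telescope_sums')
  have le: "real (k + Suc n) powr (- 1 - \<alpha>) \<le> g n - g (Suc n)" for n
    using powr_tail_telescope[of "real (k + n)" \<alpha>] assms
    by (simp add: g_def diff_divide_distrib add.commute add.left_commute)
  have s1: "summable (\<lambda>n. real (k + Suc n) powr (- 1 - \<alpha>))"
    by (rule summable_comparison_test'[OF sums_summable[OF gs], of 0]) (use le in simp)
  then show s: "summable (\<lambda>n. real (k + n) powr (- 1 - \<alpha>))"
    using summable_Suc_iff[of "\<lambda>n. real (k + n) powr (- 1 - \<alpha>)"] by simp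
  have "(\<Sum>n. real (k + Suc n) powr (- 1 - \<alpha>)) \<le> (\<Sum>n. g n - g (Suc n))"
    using le s1 gs by (intro suminf_le) (auto simp: sums_iff)
  also have "\<dots> = real k powr (- \<alpha>) / \<alpha>" using gs by (simp add: sums_iff g_def)
  finally have "(\<Sum>n. real (k + n) powr (- 1 - \<alpha>)) \<le> real k powr (- 1 - \<alpha>) + real k powr (- \<alpha>) / \<alpha>"
    using suminf_split_head[OF s] by simp
  also have "real k powr (- 1 - \<alpha>) \<le> real k powr (- \<alpha>)"
    using assms by (intro powr_mono) auto
  finally show "(\<Sum>n. real (k + n) powr (- 1 - \<alpha>)) \<le> (1 + 1 / \<alpha>) * real k powr (- \<alpha>)"
    by (simp add: algebra_simps)
qed

text \<open>Each term is at most the increment of the antiderivative, so the sum telescopes. The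
  factor 1 / (1 - \<sigma>) is the source of the blow-up at \<sigma> = 1 that the later parameter
  \<tau> avoids.\<close>

lemma sum_powr_le:
  fixes \<sigma> :: real
  assumes "0 \<le> \<sigma>" "\<sigma> < 1"
  shows "(\<Sum>m = 1..N. real m powr (- \<sigma>)) \<le> real N powr (1 - \<sigma>) / (1 - \<sigma>)"
proof (induction N)
  case (Suc N)
  show ?case
  proof (cases "N = 0")
    case True
    then show ?thesis using assms by (simp add: field_simps)
  next
    case False
    have "\<exists>z>real N. z < real N + 1 \<and> (real N + 1) powr (1 - \<sigma>) - real N powr (1 - \<sigma>) =
        ((real N + 1) - real N) * ((1 - \<sigma>) * z powr (1 - \<sigma> - 1))"
      by (rule MVT2) (simp, rule has_real_derivative_powr, use False in auto)
    then obtain z where z: "z > real N" "z < real N + 1"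
      "(real N + 1) powr (1 - \<sigma>) - real N powr (1 - \<sigma>) = (1 - \<sigma>) * z powr (- \<sigma>)" by auto
    have "(real N + 1) powr (- \<sigma>) \<le> z powr (- \<sigma>)"
      using z assms by (intro powr_mono2') auto
    then have "(1 - \<sigma>) * (real N + 1) powr (- \<sigma>) \<le> (real N + 1) powr (1 - \<sigma>) - real N powr (1 - \<sigma>)"
      using z(3) assms by (simp add: mult_left_mono)
    then have "(real N + 1) powr (- \<sigma>) \<le> (real N + 1) powr (1 - \<sigma>) / (1 - \<sigma>) - real N powr (1 - \<sigma>) / (1 - \<sigma>)"
      using assms by (simp add: pos_le_divide_eq mult.commute flip: diff_divide_distrib)
    then show ?thesis using Suc by (simp add: add.commute)
  qed
qed simp

lemma sum_inverse_le_ln: "N > 0 \<Longrightarrow> (\<Sum>k = 1..N. 1 / real k) \<le> 1 + ln (real N)"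
proof (induction N)
  case (Suc N)
  show ?case
  proof (cases "N = 0")
    case False
    have "ln (real N / (real N + 1)) \<le> real N / (real N + 1) - 1"
      using False by (intro ln_le_minus_one) auto
    then have "1 / (real N + 1) \<le> ln (real N + 1) - ln (real N)"
      using False by (simp add: ln_div field_simps)
    then show ?thesis using Suc False by (simp add: add.commute)
  qed simp
qed simp

subsection \<open>Locally normally convergent series\<close>

text \<open>The majorant may change from point to point because the bounds for zeta tails degenerate
  near \<open>s = 1\<close>, near the imaginary axis and for large |s|. The general domain type
  allows pairs of complex numbers, hence joint continuity.\<close>

lemma locally_normal_series_continuous_on:
  fixes f :: "nat \<Rightarrow> 'a::t2_space \<Rightarrow> 'b::banach"
  assumes "open S" "\<And>n. continuous_on S (f n)"
    and "\<And>x. x \<in> S \<Longrightarrow> \<exists>V M. open V \<and> x \<in> V \<and> summable M \<and> (\<forall>n. \<forall>y\<in>V \<inter> S. norm (f n y) \<le> M n)"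
  shows "continuous_on S (\<lambda>x. \<Sum>n. f n x)"
proof -
  have "isCont (\<lambda>x. \<Sum>n. f n x) x" if x: "x \<in> S" for x
  proof -
    obtain V M where V: "open V" "x \<in> V" "summable M" "\<And>n y. y \<in> V \<inter> S \<Longrightarrow> norm (f n y) \<le> M n"
      using assms(3)[OF x] by blast
    have ul: "uniform_limit (V \<inter> S) (\<lambda>n x. \<Sum>i<n. f i x) (\<lambda>x. \<Sum>i. f i x) sequentially"
      by (rule Weierstrass_m_test) (use V in auto)
    have "continuous_on (V \<inter> S) (\<lambda>x. \<Sum>i. f i x)"
      by (rule uniform_limit_theorem[OF _ ul])
        (auto intro!: always_eventually continuous_intros continuous_on_subset[OF assms(2)])
    then show ?thesis using V x assms(1) by (simp add: continuous_on_eq_continuous_at open_Int)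
  qed
  then show ?thesis by (simp add: continuous_at_imp_continuous_on)
qed

lemma locally_normal_series_holomorphic_on:
  fixes f :: "nat \<Rightarrow> complex \<Rightarrow> complex"
  assumes "open S" "\<And>n. f n holomorphic_on S"
    and "\<And>x. x \<in> S \<Longrightarrow> \<exists>V M. open V \<and> x \<in> V \<and> summable M \<and> (\<forall>n. \<forall>y\<in>V \<inter> S. norm (f n y) \<le> M n)"
  shows "(\<lambda>x. \<Sum>n. f n x) holomorphic_on S"
proof (rule holomorphic_uniform_sequence[OF assms(1)])
  show "(\<lambda>x. \<Sum>i<n. f i x) holomorphic_on S" for n
    by (intro holomorphic_intros assms)
  fix x assume x: "x \<in> S"
  obtain V M where V: "open V" "x \<in> V" "summable M" "\<And>n y. y \<in> V \<inter> S \<Longrightarrow> norm (f n y) \<le> M n"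
    using assms(3)[OF x] by blast
  obtain d where d: "d > 0" "cball x d \<subseteq> V \<inter> S"
    using V x assms(1) by (meson IntI open_Int open_contains_cball)
  have "uniform_limit (cball x d) (\<lambda>n x. \<Sum>i<n. f i x) (\<lambda>x. \<Sum>i. f i x) sequentially"
    by (rule Weierstrass_m_test[OF V(4) V(3)]) (use d in blast)
  then show "\<exists>d>0. cball x d \<subseteq> S \<and> uniform_limit (cball x d) (\<lambda>n x. \<Sum>i<n. f i x) (\<lambda>x. \<Sum>i. f i x) sequentially"
    using d by auto
qed

subsection \<open>Tails of the Riemann zeta function\<close>

lemma norm_of_nat_powr: "n > 0 \<Longrightarrow> cmod (of_nat n powr s) = real n powr Re s"
  using norm_powr_real_powr[of "of_nat n" s] by simp

text \<open>The term at \<open>Suc n\<close> minus the integral of x powr (- s) over [n, n + 1],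
  written through the antiderivative.\<close>

definition zeta_delta :: "nat \<Rightarrow> complex \<Rightarrow> complex" where
  "zeta_delta n s = of_nat (Suc n) powr (- s) +
     (of_nat (Suc n) powr (1 - s) - of_nat n powr (1 - s)) / (s - 1)"

text \<open>
  For \<open>Re s > 1\<close> this is the sum of \<open>n powr (- s)\<close> over \<open>n > m\<close>; the series below is its
  Euler--Maclaurin expansion, which converges for \<open>Re s > 0\<close>.
\<close>

definition zeta_tail :: "nat \<Rightarrow> complex \<Rightarrow> complex" where
  "zeta_tail m s = of_nat m powr (1 - s) / (s - 1) + (\<Sum>k. zeta_delta (m + k) s)"

text \<open>Mean value inequality on the real segment: the derivative - s z powr (- s - 1) is
  largest in norm at the left end, its real exponent being nonpositive by
  \<open>Re s \<ge> - 1\<close>.\<close>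

lemma of_real_powr_increment:
  fixes a b :: real
  assumes "0 < a" "a \<le> x" "x \<le> b" "a \<le> y" "y \<le> b" "Re s \<ge> - 1"
  shows "cmod (of_real x powr (- s) - of_real y powr (- s)) \<le> cmod s * a powr (- Re s - 1) * \<bar>x - y\<bar>"
proof -
  let ?S = "closed_segment (complex_of_real a) (of_real b)"
  have S: "?S = of_real ` {a..b}"
    using assms by (simp add: closed_segment_of_real closed_segment_eq_real_ivl)
  have "cmod (of_real x powr (- s) - of_real y powr (- s)) \<le>
      (cmod s * a powr (- Re s - 1)) * cmod (complex_of_real x - of_real y)"
  proof (rule field_differentiable_bound[where S = ?S and f' = "\<lambda>z. - s * z powr (- s - 1)"])
    fix z assume "z \<in> ?S"
    then obtain u where u: "z = of_real u" "a \<le> u" "u \<le> b"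
      by (metis S imageE atLeastAtMost_iff)
    show "((\<lambda>z. z powr (- s)) has_field_derivative - s * z powr (- s - 1)) (at z within ?S)"
      using u assms by (intro has_field_derivative_powr[THEN has_field_derivative_at_within]) auto
    have "cmod (z powr (- s - 1)) = u powr (- Re s - 1)"
      using u assms norm_powr_real_powr[of z "- s - 1"] by simp
    also have "\<dots> \<le> a powr (- Re s - 1)" using u assms by (intro powr_mono2') auto
    finally show "cmod (- s * z powr (- s - 1)) \<le> cmod s * a powr (- Re s - 1)"
      by (simp add: norm_mult mult_left_mono)
  qed (rule convex_closed_segment, use assms in \<open>auto simp: S\<close>)
  also have "cmod (complex_of_real x - of_real y) = \<bar>x - y\<bar>" by (metis norm_of_real of_real_diff real_norm_def)
  finally show ?thesis .
qed

lemma norm_zeta_delta_le: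
  assumes "n > 0" "Re s > 0" "s \<noteq> 1"
  shows "cmod (zeta_delta n s) \<le> cmod s * real n powr (- 1 - Re s)"
proof -
  define a b where "a = real n" and "b = real n + 1"
  have ab: "0 < a" "a \<le> b" "b - a = 1" using assms by (auto simp: a_def b_def)
  let ?S = "closed_segment (complex_of_real a) (of_real b)"
  have S: "?S = of_real ` {a..b}"
    using ab by (simp add: closed_segment_of_real closed_segment_eq_real_ivl)
  \<comment> \<open>The increment of \<open>p\<close> over [a, b] is exactly
    \<open>zeta_delta n s\<close>, and its derivative is a difference of two values of z powr (- s),
    already small by the previous lemma. This replaces an integral estimate by a mean value
    inequality.\<close>
  define p where "p z = z * of_real b powr (- s) + z powr (1 - s) / (s - 1)" for z :: complex
  have "cmod (p (of_real b) - p (of_real a)) \<le>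
      (cmod s * a powr (- 1 - Re s)) * cmod (complex_of_real b - of_real a)"
  proof (rule field_differentiable_bound[where S = ?S and f' = "\<lambda>z. of_real b powr (- s) - z powr (- s)"])
    fix z assume "z \<in> ?S"
    then obtain u where u: "z = of_real u" "a \<le> u" "u \<le> b"
      by (metis S imageE atLeastAtMost_iff)
    have "((\<lambda>z. z powr (1 - s)) has_field_derivative (1 - s) * z powr (1 - s - 1)) (at z within ?S)"
      using u ab by (intro has_field_derivative_powr[THEN has_field_derivative_at_within]) auto
    then have "(p has_field_derivative of_real b powr (- s) + (1 - s) * z powr (1 - s - 1) / (s - 1)) (at z within ?S)"
      unfolding p_def by (intro DERIV_add DERIV_cdivide DERIV_cmult_right[OF DERIV_ident, unfolded mult_1_left])
    moreover have "(1 - s) * z powr (1 - s - 1) / (s - 1) = - (z powr (- s))"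
      using assms by (simp add: divide_eq_eq algebra_simps)
    ultimately show "(p has_field_derivative of_real b powr (- s) - z powr (- s)) (at z within ?S)"
      by simp
    have "cmod (of_real b powr (- s) - z powr (- s)) \<le> cmod s * a powr (- Re s - 1) * \<bar>b - u\<bar>"
      unfolding u(1) by (rule of_real_powr_increment[where b = b]) (use u ab assms in auto)
    also have "\<dots> \<le> cmod s * a powr (- Re s - 1) * 1"
      using u ab by (intro mult_left_mono) auto
    also have "- Re s - 1 = - 1 - Re s" by simp
    finally show "cmod (of_real b powr (- s) - z powr (- s)) \<le> cmod s * a powr (- 1 - Re s)"
      by simp
  qed (rule convex_closed_segment, auto simp: S ab)
  moreover have "cmod (complex_of_real b - of_real a) = 1"
    by (simp add: ab flip: of_real_diff)
  moreover have "p (of_real b) - p (of_real a) = zeta_delta n s"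
  proof -
    have "complex_of_real b = of_nat (Suc n)" "complex_of_real a = of_nat n"
      by (simp_all add: a_def b_def)
    moreover have "of_nat (Suc n) = 1 + complex_of_nat n" by simp
    ultimately show ?thesis
      unfolding p_def zeta_delta_def by (simp add: algebra_simps diff_divide_distrib)
  qed
  ultimately show ?thesis by (simp add: a_def)
qed

lemma summable_zeta_delta:
  assumes "m > 0" "Re s > 0" "s \<noteq> 1"
  shows "summable (\<lambda>k. zeta_delta (m + k) s)"
proof (rule summable_comparison_test')
  show "summable (\<lambda>k. cmod s * real (m + k) powr (- 1 - Re s))"
    using powr_tail_sum[of "Re s" m] assms by (intro summable_mult) auto
qed (rule norm_zeta_delta_le, use assms in auto)

lemma zeta_tail_step:
  assumes "m > 0" "Re s > 0" "s \<noteq> 1"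
  shows "zeta_tail m s - zeta_tail (Suc m) s = of_nat (Suc m) powr (- s)"
  using suminf_split_head[OF summable_zeta_delta[OF assms]]
  by (simp add: zeta_tail_def zeta_delta_def diff_divide_distrib algebra_simps)

lemma zeta_tail_split:
  assumes "m > 0" "Re s > 0" "s \<noteq> 1" "m \<le> N"
  shows "zeta_tail m s = (\<Sum>n = Suc m..N. of_nat n powr (- s)) + zeta_tail N s"
  using assms(4)
proof (induction N rule: dec_induct)
  case (step N)
  then show ?case using zeta_tail_step[of N s] assms by (simp add: algebra_simps)
qed simp

text \<open>Good for fixed s and m tending to infinity, where it identifies the leading term; the
  factor |s| makes it too weak when m is about |s|.\<close>

lemma zeta_tail_approx:
  assumes "m > 0" "Re s > 0" "s \<noteq> 1"
  shows "cmod (zeta_tail m s - of_nat m powr (1 - s) / (s - 1)) \<le>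
    cmod s * (1 + 1 / Re s) * real m powr (- Re s)"
proof -
  have "cmod (\<Sum>k. zeta_delta (m + k) s) \<le> (\<Sum>k. cmod s * real (m + k) powr (- 1 - Re s))"
    using powr_tail_sum(1)[of "Re s" m] assms
    by (intro norm_suminf_le summable_mult norm_zeta_delta_le) auto
  also have "\<dots> = cmod s * (\<Sum>k. real (m + k) powr (- 1 - Re s))"
    using powr_tail_sum(1)[of "Re s" m] assms by (intro suminf_mult) auto
  also have "\<dots> \<le> cmod s * ((1 + 1 / Re s) * real m powr (- Re s))"
    using powr_tail_sum(2)[of "Re s" m] assms by (intro mult_left_mono) auto
  finally show ?thesis by (simp add: zeta_tail_def mult.assoc)
qed

lemma norm_zeta_tail_le:
  assumes "m > 0" "Re s > 0" "s \<noteq> 1"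
  shows "cmod (zeta_tail m s) \<le> (1 / cmod (s - 1) + cmod s * (1 + 1 / Re s)) * real m powr (1 - Re s)"
proof -
  have "cmod (zeta_tail m s) \<le> cmod (of_nat m powr (1 - s) / (s - 1)) +
      cmod (zeta_tail m s - of_nat m powr (1 - s) / (s - 1))"
    by (metis add.commute norm_triangle_sub)
  also have "cmod (of_nat m powr (1 - s) / (s - 1)) = 1 / cmod (s - 1) * real m powr (1 - Re s)"
    using assms by (simp add: norm_divide norm_of_nat_powr)
  also note zeta_tail_approx[OF assms]
  also have "cmod s * (1 + 1 / Re s) * real m powr (- Re s) \<le> cmod s * (1 + 1 / Re s) * real m powr (1 - Re s)"
    using assms by (intro mult_left_mono powr_mono) auto
  finally show ?thesis by (simp add: algebra_simps)
qed

lemma zeta_tail_holomorphic_on: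
  assumes "m > 0"
  shows "zeta_tail m holomorphic_on ({s. Re s > 0} - {1})"
proof -
  let ?S = "{s. Re s > 0} - {1::complex}"
  have "(\<lambda>s. \<Sum>k. zeta_delta (m + k) s) holomorphic_on ?S"
  proof (rule locally_normal_series_holomorphic_on)
    show "open ?S" by (simp add: open_Diff open_halfspace_Re_gt)
    show "(\<lambda>s. zeta_delta (m + n) s) holomorphic_on ?S" for n
      unfolding zeta_delta_def by (intro holomorphic_intros) auto
    fix x assume x: "x \<in> ?S"
    let ?V = "{s. Re s > Re x / 2} \<inter> ball 0 (cmod x + 1)"
    let ?M = "\<lambda>n. (cmod x + 1) * real (m + n) powr (- 1 - Re x / 2)"
    have "cmod (zeta_delta (m + n) y) \<le> ?M n" if y: "y \<in> ?V \<inter> ?S" for n y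
    proof -
      have "cmod (zeta_delta (m + n) y) \<le> cmod y * real (m + n) powr (- 1 - Re y)"
        using y assms by (intro norm_zeta_delta_le) auto
      also have "\<dots> \<le> ?M n"
        using y assms by (intro mult_mono powr_mono) auto
      finally show ?thesis .
    qed
    moreover have "summable ?M"
      using powr_tail_sum(1)[of "Re x / 2" m] x assms by (intro summable_mult) auto
    moreover have "open ?V" by (intro open_Int open_halfspace_Re_gt open_ball)
    moreover have "x \<in> ?V" using x by auto
    ultimately show "\<exists>V M. open V \<and> x \<in> V \<and> summable M \<and> (\<forall>n. \<forall>y\<in>V \<inter> ?S. cmod (zeta_delta (m + n) y) \<le> M n)"
      by blast
  qed
  then show ?thesis unfolding zeta_tail_def by (intro holomorphic_intros) auto
qed

text \<open>The recurrence telescopes, and for \<open>Re s > 1\<close> the tails tend to 0, so no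
  constant is left over.\<close>

lemma zeta_tail_sums:
  assumes "m > 0" "Re s > 1"
  shows "(\<lambda>n. of_nat (Suc (m + n)) powr (- s)) sums zeta_tail m s"
proof -
  have s: "Re s > 0" "s \<noteq> 1" using assms by auto
  let ?C = "1 / cmod (s - 1) + cmod s * (1 + 1 / Re s)"
  have lim: "(\<lambda>n. zeta_tail (m + n) s) \<longlonglongrightarrow> 0"
  proof (rule Lim_null_comparison)
    show "\<forall>\<^sub>F n in sequentially. cmod (zeta_tail (m + n) s) \<le> ?C * real (m + n) powr (1 - Re s)"
      using s assms by (intro always_eventually allI norm_zeta_tail_le) auto
    have "(\<lambda>n. real (m + n) powr (1 - Re s)) \<longlonglongrightarrow> 0"
      using assms by (intro tendsto_powr_shift_0) auto
    then show "(\<lambda>n. ?C * real (m + n) powr (1 - Re s)) \<longlonglongrightarrow> 0"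
      by (rule tendsto_mult_right_zero)
  qed
  show ?thesis
    using telescope_sums'[OF lim] zeta_tail_step[of _ s] assms s by simp
qed

subsection \<open>Truncation beyond the conductor\<close>

text \<open>Nonzero periods of exp have norm at least 2 pi. Radius 2 is ample: it leaves the closed
  unit disc, the range of the later arguments, in the interior.\<close>

lemma exp_minus_neq_1:
  fixes w :: complex
  assumes "w \<noteq> 0" "cmod w < 2"
  shows "exp (- w) \<noteq> 1"
proof
  assume "exp (- w) = 1"
  then obtain n :: int where n: "Re w = 0" "- Im w = of_int (2 * n) * pi"
    by (auto simp: exp_eq_1)
  have "n \<noteq> 0" using n assms by (auto simp: complex_eq_iff)
  then have "1 \<le> \<bar>real_of_int n\<bar>" by linarith
  then have "2 * 1 * 2 \<le> 2 * \<bar>real_of_int n\<bar> * pi"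
    using pi_ge_two by (intro mult_mono) auto
  also have "\<dots> = \<bar>- Im w\<bar>" unfolding n(2) by (simp add: abs_mult)
  also have "\<dots> = \<bar>Im w\<bar>" by simp
  also have "\<dots> \<le> cmod w" by (rule abs_Im_le_cmod)
  finally show False using assms by simp
qed

text \<open>1 / (1 - exp (- w)) has a simple pole of residue 1 at 0. After subtracting 1 / w the
  singularity is removable, since w times the difference tends to 0; the extension and its
  derivative are then bounded on the compact unit disc, which gives the bound and the Lipschitz
  estimate with one constant.\<close>

lemma reciprocal_one_minus_exp_regular:
  obtains L :: real where "L \<ge> 0"
    "\<And>w. w \<noteq> 0 \<Longrightarrow> cmod w \<le> 1 \<Longrightarrow> cmod (1 / (1 - exp (- w)) - 1 / w) \<le> L"
    "\<And>v w. \<lbrakk>v \<noteq> 0; cmod v \<le> 1; w \<noteq> 0; cmod w \<le> 1\<rbrakk> \<Longrightarrow>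
       cmod ((1 / (1 - exp (- v)) - 1 / v) - (1 / (1 - exp (- w)) - 1 / w)) \<le> L * cmod (v - w)"
proof -
  define \<phi> :: "complex \<Rightarrow> complex" where "\<phi> w = 1 / (1 - exp (- w)) - 1 / w" for w
  have hol: "\<phi> holomorphic_on ball 0 2 - {0}"
    unfolding \<phi>_def by (intro holomorphic_intros) (use exp_minus_neq_1 in force)+
  have "((\<lambda>w::complex. 1 - exp (- w)) has_field_derivative 1) (at 0)"
    by (auto intro!: derivative_eq_intros)
  then have "((\<lambda>w::complex. (1 - exp (- w)) / w) \<longlongrightarrow> 1) (at 0)"
    by (simp add: has_field_derivative_iff)
  then have "((\<lambda>w::complex. inverse ((1 - exp (- w)) / w) - 1) \<longlongrightarrow> inverse 1 - 1) (at 0)"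
    by (intro tendsto_intros) auto
  moreover have "\<forall>\<^sub>F w in at 0. inverse ((1 - exp (- w)) / w) - 1 = (w - 0) * \<phi> w"
    unfolding eventually_at by (intro exI[of _ 1]) (auto simp: \<phi>_def right_diff_distrib)
  ultimately have "((\<lambda>w. (w - 0) * \<phi> w) \<longlongrightarrow> 0) (at 0)"
    by (auto elim: Lim_transform_eventually)
  then obtain g where g: "g holomorphic_on ball 0 2" "\<And>z. z \<in> ball 0 2 - {0} \<Longrightarrow> g z = \<phi> z"
    using holomorphic_on_extend_lim[OF hol] by (auto simp: interior_open)
  have sub: "cball 0 1 \<subseteq> ball (0::complex) 2" by auto
  have "compact (g ` cball 0 1)"
    using g(1) sub by (intro compact_continuous_image holomorphic_on_imp_continuous_on holomorphic_on_subset[OF g(1)]) auto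
  then obtain L1 where L1: "\<And>z. z \<in> cball 0 1 \<Longrightarrow> cmod (g z) \<le> L1"
    by (meson bounded_iff compact_imp_bounded imageI)
  have "compact (deriv g ` cball 0 1)"
    using g(1) sub by (intro compact_continuous_image holomorphic_on_imp_continuous_on
        holomorphic_on_subset[OF holomorphic_deriv[OF g(1)]]) auto
  then obtain L2 where L2: "\<And>z. z \<in> cball 0 1 \<Longrightarrow> cmod (deriv g z) \<le> L2"
    by (meson bounded_iff compact_imp_bounded imageI)
  show thesis
  proof
    show "0 \<le> max 0 (max L1 L2)" by simp
    show "cmod (1 / (1 - exp (- w)) - 1 / w) \<le> max 0 (max L1 L2)" if "w \<noteq> 0" "cmod w \<le> 1" for w
      using L1[of w] g(2)[of w] that by (simp add: \<phi>_def)
    fix v w :: complex assume vw: "v \<noteq> 0" "cmod v \<le> 1" "w \<noteq> 0" "cmod w \<le> 1"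
    have "cmod (g v - g w) \<le> L2 * cmod (v - w)"
    proof (rule field_differentiable_bound[where S = "cball 0 1" and f' = "deriv g"])
      fix z :: complex assume "z \<in> cball 0 1"
      then have "z \<in> ball 0 2" by auto
      then show "(g has_field_derivative deriv g z) (at z within cball 0 1)"
        by (intro holomorphic_derivI[OF g(1)]) auto
    qed (use vw L2 in auto)
    also have "\<dots> \<le> max 0 (max L1 L2) * cmod (v - w)" by (intro mult_right_mono) auto
    finally show "cmod ((1 / (1 - exp (- v)) - 1 / v) - (1 / (1 - exp (- w)) - 1 / w)) \<le> max 0 (max L1 L2) * cmod (v - w)"
      using g(2)[of v] g(2)[of w] vw by (simp add: \<phi>_def)
  qed
qed

lemma ln_one_plus_inverse_bounds:
  fixes x :: real
  assumes "x > 0"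
  shows "1 / (x + 1) \<le> ln (1 + 1 / x)" "ln (1 + 1 / x) \<le> 1 / x"
proof -
  have "ln (x / (x + 1)) \<le> x / (x + 1) - 1"
    using assms by (intro ln_le_minus_one) auto
  moreover have "ln (1 + 1 / x) = - ln (x / (x + 1))"
    using assms by (simp add: ln_div add_divide_distrib[symmetric] field_simps flip: ln_inverse)
  ultimately show "1 / (x + 1) \<le> ln (1 + 1 / x)" using assms by (simp add: field_simps)
  show "ln (1 + 1 / x) \<le> 1 / x" using assms by (intro ln_add_one_self_le_self) auto
qed

text \<open>The derivative of 1 / ln (1 + 1 / y) is 1 / (y (y + 1) ln (1 + 1 / y)^2), and the bounds
  1 / (y + 1) and 1 / y for the logarithm squeeze it to 1 + O(1 / y). Knowing 1 / ln (1 + 1 / x) = x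
  + O(1) alone would not control the increments.\<close>

lemma inverse_ln_increment:
  fixes x :: real
  assumes "x \<ge> 1"
  shows "\<bar>1 / ln (1 + 1 / (x + 1)) - 1 / ln (1 + 1 / x) - 1\<bar> \<le> 1 / x"
proof -
  have pos: "ln (1 + 1 / y) > 0" if "y > 0" for y :: real
    using that by (intro ln_gt_zero) simp
  have "\<exists>z>x. z < x + 1 \<and> 1 / ln (1 + 1 / (x + 1)) - 1 / ln (1 + 1 / x) =
      ((x + 1) - x) * (1 / (z * (z + 1) * (ln (1 + 1 / z))\<^sup>2))"
  proof (rule MVT2)
    fix y assume y: "x \<le> y"
    then have y0: "y > 0" using assms by simp
    have "((\<lambda>y. 1 + 1 / y) has_real_derivative - 1 / y\<^sup>2) (at y)"
      using y0 by (auto intro!: derivative_eq_intros simp: power2_eq_square)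
    then have "((\<lambda>y. ln (1 + 1 / y)) has_real_derivative 1 / (1 + 1 / y) * (- 1 / y\<^sup>2)) (at y)"
      using y0 by (intro DERIV_chain2[where f = ln] DERIV_ln_divide) (auto simp: add_pos_pos)
    also have "1 / (1 + 1 / y) * (- 1 / y\<^sup>2) = - 1 / (y * (y + 1))"
      using y0 by (simp add: divide_simps power2_eq_square)
    finally have "((\<lambda>y. ln (1 + 1 / y)) has_real_derivative - 1 / (y * (y + 1))) (at y)" .
    from DERIV_inverse'[OF this] pos[OF y0]
    have "((\<lambda>y. inverse (ln (1 + 1 / y))) has_real_derivative
        - (inverse (ln (1 + 1 / y)) * (- 1 / (y * (y + 1))) * inverse (ln (1 + 1 / y)))) (at y)"
      by simp
    also have "- (inverse (ln (1 + 1 / y)) * (- 1 / (y * (y + 1))) * inverse (ln (1 + 1 / y))) =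
        1 / (y * (y + 1) * (ln (1 + 1 / y))\<^sup>2)"
      by (simp add: divide_inverse power2_eq_square)
    finally show "((\<lambda>y. 1 / ln (1 + 1 / y)) has_real_derivative 1 / (y * (y + 1) * (ln (1 + 1 / y))\<^sup>2)) (at y)"
      by (simp add: inverse_eq_divide)
  qed simp
  then obtain z where z: "z > x" and eq: "1 / ln (1 + 1 / (x + 1)) - 1 / ln (1 + 1 / x) =
      1 / (z * (z + 1) * (ln (1 + 1 / z))\<^sup>2)" by auto
  have z0: "z > 0" using z assms by simp
  let ?l = "ln (1 + 1 / z)"
  have "(1 / (z + 1))\<^sup>2 \<le> ?l\<^sup>2" "?l\<^sup>2 \<le> (1 / z)\<^sup>2"
    using ln_one_plus_inverse_bounds[OF z0] z0 by (intro power_mono; simp)+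
  then have "z * (z + 1) * (1 / (z + 1))\<^sup>2 \<le> z * (z + 1) * ?l\<^sup>2" "z * (z + 1) * ?l\<^sup>2 \<le> z * (z + 1) * (1 / z)\<^sup>2"
    using z0 by (auto intro!: mult_left_mono)
  moreover have "z * (z + 1) * (1 / (z + 1))\<^sup>2 = z / (z + 1)" "z * (z + 1) * (1 / z)\<^sup>2 = (z + 1) / z"
    using z0 by (auto simp: power2_eq_square divide_simps)
  ultimately have b: "z / (z + 1) \<le> z * (z + 1) * ?l\<^sup>2" "z * (z + 1) * ?l\<^sup>2 \<le> (z + 1) / z" by auto
  have "1 / ((z + 1) / z) \<le> 1 / (z * (z + 1) * ?l\<^sup>2)"
    using b z0 pos[OF z0] by (intro divide_left_mono mult_pos_pos) auto
  moreover have "1 / (z * (z + 1) * ?l\<^sup>2) \<le> 1 / (z / (z + 1))"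
    using b z0 pos[OF z0] by (intro divide_left_mono mult_pos_pos) auto
  moreover have "1 / ((z + 1) / z) = 1 - 1 / (z + 1)" "1 / (z / (z + 1)) = 1 + 1 / z"
    using z0 by (auto simp: divide_simps)
  moreover have "1 / (z + 1) \<le> 1 / x" "1 / z \<le> 1 / x"
    using z assms by (auto intro!: divide_left_mono)
  ultimately show ?thesis unfolding eq by linarith
qed

text \<open>
  The naive remainder \<open>|s| m powr (- \<sigma>)\<close> loses a factor \<open>|s|\<close> when \<open>m\<close> is about \<open>|s|\<close>. As in the
  Kusmin--Landau inequality, write \<open>n powr (- s)\<close> as the difference of \<open>n powr (- s) * h n\<close>, where
  \<open>h n = 1 / (1 - ((n + 1) / n) powr (- s))\<close>, up to the correction coming from the variation of \<open>h\<close>;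
  since \<open>h n = n / s + O(1)\<close> with \<open>h (n + 1) - h n = 1 / s + O(1 / n)\<close>, that correction is
  \<open>(n + 1) powr (- s) / s\<close> up to an absolutely summable error.
\<close>

lemma norm_zeta_tail_le_large:
  fixes \<sigma> :: real
  assumes \<sigma>: "\<sigma> > 0"
  obtains C :: real where "C \<ge> 0"
    "\<And>s m. \<lbrakk>Re s = \<sigma>; 2 \<le> cmod s; cmod s \<le> real m\<rbrakk> \<Longrightarrow>
       cmod (zeta_tail m s) \<le> C * real m powr (1 - \<sigma>) / cmod s"
proof -
  obtain L where L: "L \<ge> 0"
    "\<And>w. w \<noteq> 0 \<Longrightarrow> cmod w \<le> 1 \<Longrightarrow> cmod (1 / (1 - exp (- w)) - 1 / w) \<le> L"
    "\<And>v w. \<lbrakk>v \<noteq> 0; cmod v \<le> 1; w \<noteq> 0; cmod w \<le> 1\<rbrakk> \<Longrightarrow>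
       cmod ((1 / (1 - exp (- v)) - 1 / v) - (1 / (1 - exp (- w)) - 1 / w)) \<le> L * cmod (v - w)"
    by (fact reciprocal_one_minus_exp_regular)
  define K where "K = (1 + 2 * L) * (1 + 1 / \<sigma>)"
  have K: "K \<ge> 0" using L \<sigma> by (simp add: K_def)
  show thesis
  proof
    show "0 \<le> 2 * (3 + L + K)" using L K by simp
    fix s :: complex and m :: nat
    assume s: "Re s = \<sigma>" "2 \<le> cmod s" "cmod s \<le> real m"
    have m: "m \<ge> 2" using s by simp
    have s0: "s \<noteq> 0" "s \<noteq> 1" using s by auto
    define l where "l n = ln (1 + 1 / real n)" for n
    define w where "w n = s * of_real (l n)" for n
    define h where "h n = 1 / (1 - exp (- w n))" for n
    define \<phi> where "\<phi> n = h n - 1 / w n" for n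
    define f where "f n = of_nat n powr (- s)" for n
    define e where "e n = h n - h (Suc n) + 1 / s" for n
    \<comment> \<open>Telescoping \<open>f n * h n\<close> yields \<open>f n\<close> plus
      \<open>f (Suc n) * (h n - h (Suc n) + 1)\<close> up to the shift of index, and
      \<open>h n - h (Suc n)\<close> is \<open>- 1 / s\<close> up to \<open>e n\<close>. Collecting
      the \<open>- 1 / s\<close> gives the factor \<open>1 - 1 / s\<close> on the tail; what remains
      has increments \<open>f (Suc n) * e n\<close>.\<close>
    define u where "u n = f n * h n - f n - (1 - 1 / s) * zeta_tail n s" for n
    have lpos: "l n > 0" if "n \<ge> m" for n
      unfolding l_def using that m by (intro ln_gt_zero) simp
    have lb: "1 / (real n + 1) \<le> l n" "l n \<le> 1 / real n" if "n \<ge> m" for n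
      using ln_one_plus_inverse_bounds[of "real n"] that m by (auto simp: l_def)
    have w: "w n \<noteq> 0" "cmod (w n) \<le> 1" if "n \<ge> m" for n
    proof -
      show "w n \<noteq> 0" using lpos[OF that] s0 by (simp add: w_def)
      have "cmod (w n) \<le> real n * (1 / real n)"
        unfolding w_def norm_mult using lb[OF that] lpos[OF that] s that by (intro mult_mono) auto
      then show "cmod (w n) \<le> 1" using that m by simp
    qed
    have nf: "cmod (f n) = real n powr (- \<sigma>)" if "n \<ge> m" for n
      using that m s by (simp add: f_def norm_of_nat_powr)
    have step: "f (Suc n) = f n * exp (- w n)" if "n \<ge> m" for n
    proof -
      have n: "n > 0" using that m by simp
      have "l n = ln (real (Suc n) / real n)" using n by (simp add: l_def field_simps)
      then have "ln (real (Suc n)) = ln (real n) + l n" using n by (simp add: ln_div)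
      then have "- s * of_real (ln (real (Suc n))) = - s * of_real (ln (real n)) + - w n"
        by (simp add: w_def algebra_simps)
      then have "exp (- s * of_real (ln (real (Suc n)))) = exp (- s * of_real (ln (real n))) * exp (- w n)"
        by (simp only: exp_add)
      then show ?thesis using n unfolding f_def powr_def
        by (simp add: Ln_of_nat del: of_nat_Suc)
    qed
    have h: "h n = 1 + exp (- w n) * h n" if "n \<ge> m" for n
      using exp_minus_neq_1[of "w n"] w[OF that] by (simp add: h_def field_simps)
    have udiff: "u n - u (Suc n) = f (Suc n) * e n" if "n \<ge> m" for n
    proof -
      have "f n * h n = f n * (1 + exp (- w n) * h n)" using h[OF that] by simp
      then have 1: "f n * h n = f n + f (Suc n) * h n" by (simp add: step[OF that] algebra_simps)
      have "zeta_tail n s - zeta_tail (Suc n) s = f (Suc n)"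
        unfolding f_def using that m s \<sigma> s0 by (intro zeta_tail_step) auto
      then have 2: "zeta_tail n s = zeta_tail (Suc n) s + f (Suc n)" by (simp add: algebra_simps)
      show ?thesis unfolding u_def e_def 1 2 by (simp add: algebra_simps)
    qed
    have hphi: "h n = of_real (1 / l n) / s + \<phi> n" if "n \<ge> m" for n
      by (simp add: \<phi>_def w_def field_simps)
    have phi: "cmod (\<phi> n) \<le> L" if "n \<ge> m" for n
      unfolding \<phi>_def h_def using w[OF that] by (rule L(2))
    have e: "cmod (e n) \<le> (1 + 2 * L) / real n" if n: "n \<ge> m" for n
    proof -
      have n': "Suc n \<ge> m" using n by simp
      have n1: "real n \<ge> 2" using n m by simp
      have "e n = - of_real (1 / l (Suc n) - 1 / l n - 1) / s + (\<phi> n - \<phi> (Suc n))"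
        unfolding e_def hphi[OF n] hphi[OF n'] by (simp add: diff_divide_distrib add_divide_distrib algebra_simps)
      then have "cmod (e n) \<le> cmod (- of_real (1 / l (Suc n) - 1 / l n - 1) / s) + cmod (\<phi> n - \<phi> (Suc n))"
        by (simp only: norm_triangle_ineq)
      also have "cmod (- of_real (1 / l (Suc n) - 1 / l n - 1) / s) = \<bar>1 / l (Suc n) - 1 / l n - 1\<bar> / cmod s"
        by (simp only: norm_divide norm_minus_cancel norm_of_real)
      also have "\<dots> \<le> (1 / real n) / 1"
        using inverse_ln_increment[of "real n"] n1 s by (intro frac_le) (auto simp: l_def add.commute)
      \<comment> \<open>\<open>l n\<close> changes by at most 2 / n^2, and \<open>w n\<close> is
        \<open>l n\<close> times s with |s| \<le> n, so \<open>w n\<close> moves by at most 2 / n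
        and the Lipschitz bound applies.\<close>
      also have "cmod (\<phi> n - \<phi> (Suc n)) \<le> L * (2 / real n)"
      proof -
        have "l (Suc n) \<le> l n" unfolding l_def using n1
          by (intro ln_mono) (auto intro!: divide_left_mono add_pos_pos)
        moreover have "l n - l (Suc n) \<le> 1 / real n - 1 / (real n + 2)"
          using lb(2)[OF n] lb(1)[OF n'] by (simp add: add.commute)
        moreover have "1 / real n - 1 / (real n + 2) \<le> 2 / (real n * real n)"
          using n1 by (simp add: divide_simps)
        ultimately have ll: "\<bar>l n - l (Suc n)\<bar> \<le> 2 / (real n * real n)" by linarith
        have "w n - w (Suc n) = s * of_real (l n - l (Suc n))" by (simp add: w_def algebra_simps)
        then have "cmod (w n - w (Suc n)) = cmod s * \<bar>l n - l (Suc n)\<bar>"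
          by (simp only: norm_mult norm_of_real)
        also have "\<dots> \<le> real n * (2 / (real n * real n))"
          using s n ll by (intro mult_mono) auto
        finally have "L * cmod (w n - w (Suc n)) \<le> L * (2 / real n)"
          using n1 by (intro mult_left_mono L(1)) simp
        moreover have "cmod (\<phi> n - \<phi> (Suc n)) \<le> L * cmod (w n - w (Suc n))"
          unfolding \<phi>_def h_def using w[OF n] w[OF n'] by (intro L(3))
        ultimately show ?thesis by linarith
      qed
      finally show ?thesis by (simp add: add_divide_distrib mult.commute)
    qed
    \<comment> \<open>For \<sigma> \<le> 1 neither \<open>f n * h n\<close> nor the tail need tend
      to 0. Their leading parts n powr (1 - s) / s cancel, because (1 - 1 / s) / (s - 1) = 1 / s.
      The constant may depend on s: only the limit of \<open>u\<close> is taken from this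
      bound.\<close>
    have ubound: "cmod (u n) \<le> ((1 + L + 1) + cmod (1 - 1 / s) * (cmod s * (1 + 1 / \<sigma>))) * real n powr (- \<sigma>)"
      if n: "n \<ge> m" for n
    proof -
      let ?r = "zeta_tail n s - of_nat n powr (1 - s) / (s - 1)"
      have n0: "n > 0" using n m by simp
      have "of_nat n powr (1 - s) = f n * of_nat n"
        using n0 by (simp add: f_def powr_diff powr_minus field_simps)
      then have eq: "(1 - 1 / s) * (of_nat n powr (1 - s) / (s - 1)) = f n * (of_nat n / s)"
        using s0 by (simp add: field_simps)
      have "u n = f n * (h n - 1) - (1 - 1 / s) * ?r - (1 - 1 / s) * (of_nat n powr (1 - s) / (s - 1))"
        unfolding u_def by (simp add: algebra_simps)
      also have "\<dots> = f n * (of_real (1 / l n - real n) / s + \<phi> n - 1) - (1 - 1 / s) * ?r"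
        unfolding eq hphi[OF n] by (simp add: algebra_simps diff_divide_distrib)
      finally have "cmod (u n) \<le> cmod (f n * (of_real (1 / l n - real n) / s + \<phi> n - 1)) + cmod ((1 - 1 / s) * ?r)"
        by (simp only: norm_triangle_ineq4)
      also have "cmod (f n * (of_real (1 / l n - real n) / s + \<phi> n - 1)) \<le> real n powr (- \<sigma>) * (1 + L + 1)"
      proof -
        have "real n \<le> 1 / l n" "1 / l n \<le> real n + 1"
          using lb[OF n] lpos[OF n] n0 by (auto simp: field_simps)
        then have "cmod (of_real (1 / l n - real n) / s) \<le> 1 / 1"
          unfolding norm_divide norm_of_real using s by (intro frac_le) auto
        then have "cmod (of_real (1 / l n - real n) / s + \<phi> n - 1) \<le> 1 + L + 1"
          using phi[OF n] norm_triangle_ineq[of "of_real (1 / l n - real n) / s" "\<phi> n"]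
            norm_triangle_ineq4[of "of_real (1 / l n - real n) / s + \<phi> n" 1] by simp
        then show ?thesis unfolding norm_mult nf[OF n] by (intro mult_left_mono) auto
      qed
      also have "cmod ((1 - 1 / s) * ?r) \<le> cmod (1 - 1 / s) * (cmod s * (1 + 1 / \<sigma>) * real n powr (- \<sigma>))"
        unfolding norm_mult using zeta_tail_approx[of n s] n0 s s0 \<sigma> by (intro mult_left_mono) auto
      finally show ?thesis by (simp add: algebra_simps)
    qed
    have lim: "(\<lambda>k. u (m + k)) \<longlonglongrightarrow> 0"
    proof (rule Lim_null_comparison)
      let ?D = "(1 + L + 1) + cmod (1 - 1 / s) * (cmod s * (1 + 1 / \<sigma>))"
      show "\<forall>\<^sub>F k in sequentially. cmod (u (m + k)) \<le> ?D * real (m + k) powr (- \<sigma>)"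
        by (intro always_eventually allI ubound) simp
      have "(\<lambda>n. real (m + n) powr (- \<sigma>)) \<longlonglongrightarrow> 0"
        using \<sigma> by (intro tendsto_powr_shift_0) auto
      then show "(\<lambda>n. ?D * real (m + n) powr (- \<sigma>)) \<longlonglongrightarrow> 0"
        by (rule tendsto_mult_right_zero)
    qed
    have sums: "(\<lambda>k. f (Suc (m + k)) * e (m + k)) sums u m"
      using telescope_sums'[OF lim] udiff by simp
    have m0: "m > 0" using m by simp
    note pts = powr_tail_sum[OF \<sigma> m0]
    \<comment> \<open>The extra 1 / n in \<open>e n\<close> makes the series converge absolutely for
      every \<sigma> > 0, with a constant independent of s.\<close>
    have "cmod (\<Sum>k. f (Suc (m + k)) * e (m + k)) \<le> (\<Sum>k. (1 + 2 * L) * real (m + k) powr (- 1 - \<sigma>))"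
    proof (rule norm_suminf_le)
      fix k
      have "cmod (f (Suc (m + k))) \<le> real (m + k) powr (- \<sigma>)"
        using nf[of "Suc (m + k)"] m \<sigma> by (auto intro!: powr_mono2')
      then have "cmod (f (Suc (m + k)) * e (m + k)) \<le> real (m + k) powr (- \<sigma>) * ((1 + 2 * L) / real (m + k))"
        unfolding norm_mult by (intro mult_mono e) auto
      also have "\<dots> = (1 + 2 * L) * real (m + k) powr (- 1 - \<sigma>)"
      proof -
        have "real (m + k) powr (- 1 - \<sigma>) = real (m + k) powr (- \<sigma> - 1)"
          by (rule arg_cong[where f = "\<lambda>x. real (m + k) powr x"]) simp
        also have "\<dots> = real (m + k) powr (- \<sigma>) / real (m + k)"
          using m by (simp add: powr_diff)
        finally show ?thesis by simp
      qed
      finally show "cmod (f (Suc (m + k)) * e (m + k)) \<le> (1 + 2 * L) * real (m + k) powr (- 1 - \<sigma>)" .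
    qed (intro summable_mult pts)
    also have "\<dots> = (1 + 2 * L) * (\<Sum>k. real (m + k) powr (- 1 - \<sigma>))"
      by (intro suminf_mult pts)
    also have "\<dots> \<le> (1 + 2 * L) * ((1 + 1 / \<sigma>) * real m powr (- \<sigma>))"
      using L by (intro mult_left_mono pts) auto
    finally have um: "cmod (u m) \<le> K * real m powr (- \<sigma>)"
      using sums by (simp add: sums_iff K_def mult.assoc)
    \<comment> \<open>As this ratio is at least 1, every term of size m powr (- \<sigma>) is
      absorbed into m powr (1 - \<sigma>) / |s|.\<close>
    let ?x = "real m / cmod s"
    have x: "1 \<le> ?x" using s s0 by (simp add: pos_le_divide_eq)
    have "(1 - 1 / s) * zeta_tail m s = f m * (h m - 1) - u m" by (simp add: u_def algebra_simps)
    then have "cmod ((1 - 1 / s) * zeta_tail m s) \<le> cmod (f m * (h m - 1)) + cmod (u m)"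
      by (simp only: norm_triangle_ineq4)
    also have "cmod (f m * (h m - 1)) \<le> real m powr (- \<sigma>) * ((3 + L) * ?x)"
    proof -
      have "1 / l m \<le> real m + 1" "1 / l m > 0"
        using lb(1)[of m] lpos[of m] by (auto simp: field_simps)
      then have "cmod (of_real (1 / l m) / s) \<le> 2 * real m / cmod s"
        unfolding norm_divide norm_of_real using m by (intro divide_right_mono) auto
      then have "cmod (h m) \<le> 2 * ?x + L"
        using hphi[of m] phi[of m] norm_triangle_ineq[of "of_real (1 / l m) / s" "\<phi> m"] by simp
      then have "cmod (h m - 1) \<le> 2 * ?x + L + 1"
        using norm_triangle_ineq4[of "h m" 1] by simp
      also have "\<dots> \<le> (3 + L) * ?x"
        using mult_left_mono[OF x L(1)] x by (simp only: ring_distribs)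
      finally show ?thesis unfolding norm_mult nf[OF order_refl] by (intro mult_left_mono) auto
    qed
    also have "cmod (u m) \<le> real m powr (- \<sigma>) * (K * ?x)"
    proof -
      have "K * 1 \<le> K * ?x" using K x by (rule mult_left_mono[rotated])
      then have "real m powr (- \<sigma>) * K \<le> real m powr (- \<sigma>) * (K * ?x)" by (intro mult_left_mono) auto
      then show ?thesis using um by (simp only: mult.commute[of K "real m powr (- \<sigma>)"])
    qed
    finally have fin: "cmod ((1 - 1 / s) * zeta_tail m s) \<le> (3 + L + K) * (real m powr (- \<sigma>) * ?x)"
      by (simp only: ring_distribs mult.commute mult.left_commute)
    \<comment> \<open>Here |s| \<ge> 2 allows division by \<open>1 - 1 / s\<close> at the cost of a
      factor 2.\<close>
    have half: "1 / 2 \<le> cmod (1 - 1 / s)"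
    proof -
      have "cmod (1 / s) \<le> 1 / 2" using s s0 by (simp add: norm_divide)
      then show ?thesis using norm_triangle_ineq2[of 1 "1 / s"] by simp
    qed
    have "1 / 2 * cmod (zeta_tail m s) \<le> cmod (1 - 1 / s) * cmod (zeta_tail m s)"
      using half by (intro mult_right_mono) auto
    also have "\<dots> \<le> (3 + L + K) * (real m powr (- \<sigma>) * ?x)" using fin by (simp only: norm_mult)
    finally have "cmod (zeta_tail m s) \<le> 2 * (3 + L + K) * (real m powr (- \<sigma>) * ?x)" by (simp only: mult.assoc)
    also have "real m powr (- \<sigma>) * ?x = real m powr (1 - \<sigma>) / cmod s"
      using m by (simp add: powr_diff powr_minus divide_inverse)
    finally show "cmod (zeta_tail m s) \<le> 2 * (3 + L + K) * real m powr (1 - \<sigma>) / cmod s" by simp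
  qed
qed

subsection \<open>Analytic continuation of the double zeta function\<close>

text \<open>Two half-space conditions keep the domain convex, as a continuation requires. It
  contains every line \<open>Re s2 = \<sigma>\<close> of the theorem, and the only singular
  hyperplane meeting it is \<open>s2 = 1\<close>.\<close>

definition double_zeta_dom :: "(complex \<times> complex) set" where
  "double_zeta_dom = {p. Re (snd p) > 0 \<and> Re (fst p + snd p) > 2}"

definition double_zeta_ext :: "complex \<Rightarrow> complex \<Rightarrow> complex" where
  "double_zeta_ext s1 s2 = (\<Sum>m. 1 / of_nat (Suc m) powr s1 * zeta_tail (Suc m) s2)"

lemma double_zeta_dom_diff_sing:
  "double_zeta_dom - double_zeta_sing = {p. Re (snd p) > 0 \<and> Re (fst p + snd p) > 2 \<and> snd p \<noteq> 1}"
proof -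
  have "\<not> (s1 + s2 = 2 \<or> s1 + s2 = 1 \<or> (\<exists>k::nat. s1 + s2 = - 2 * of_nat k))"
    if "Re (s1 + s2) > 2" for s1 s2 :: complex
  proof
    assume "s1 + s2 = 2 \<or> s1 + s2 = 1 \<or> (\<exists>k::nat. s1 + s2 = - 2 * of_nat k)"
    then have "Re (s1 + s2) \<le> 2" by (elim disjE exE) simp_all
    with that show False by simp
  qed
  then show ?thesis unfolding double_zeta_dom_def double_zeta_sing_def by auto
qed

lemma norm_double_zeta_ext_term_le:
  assumes "Re s2 > 0" "s2 \<noteq> 1"
  shows "cmod (1 / of_nat (Suc m) powr s1 * zeta_tail (Suc m) s2) \<le>
    (1 / cmod (s2 - 1) + cmod s2 * (1 + 1 / Re s2)) * real (Suc m) powr (1 - Re (s1 + s2))"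
proof -
  let ?C = "1 / cmod (s2 - 1) + cmod s2 * (1 + 1 / Re s2)"
  have "cmod (1 / of_nat (Suc m) powr s1 * zeta_tail (Suc m) s2) =
      real (Suc m) powr (- Re s1) * cmod (zeta_tail (Suc m) s2)"
    by (simp add: norm_mult norm_divide norm_of_nat_powr powr_minus divide_inverse norm_inverse del: of_nat_Suc)
  also have "\<dots> \<le> real (Suc m) powr (- Re s1) * (?C * real (Suc m) powr (1 - Re s2))"
    using assms by (intro mult_left_mono norm_zeta_tail_le) auto
  also have "\<dots> = ?C * (real (Suc m) powr (- Re s1) * real (Suc m) powr (1 - Re s2))"
    by (simp only: mult.left_commute)
  also have "real (Suc m) powr (- Re s1) * real (Suc m) powr (1 - Re s2) = real (Suc m) powr (1 - Re (s1 + s2))"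
    by (simp add: powr_add[symmetric] algebra_simps del: of_nat_Suc)
  finally show ?thesis .
qed

text \<open>The termwise bound depends on the point only through continuous quantities, so replacing
  them by slightly worse values than at p gives one majorant; half of the excess of
  \<open>Re (s1 + s2)\<close> over 2 is kept for convergence. The neighbourhood is taken in both
  variables at once: it serves joint continuity, and its slices serve holomorphy in each
  variable.\<close>

lemma double_zeta_ext_locally_normal:
  assumes p: "p \<in> double_zeta_dom - double_zeta_sing"
  shows "\<exists>V M. open V \<and> p \<in> V \<and> summable M \<and>
    (\<forall>m. \<forall>q\<in>V. cmod (1 / of_nat (Suc m) powr fst q * zeta_tail (Suc m) (snd q)) \<le> M m)"
proof -
  obtain a b where ab: "p = (a, b)" by (cases p)
  have b: "Re b > 0" "b \<noteq> 1" "Re (a + b) > 2"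
    using p unfolding double_zeta_dom_diff_sing ab by auto
  define \<epsilon> where "\<epsilon> = (Re (a + b) - 2) / 2"
  have \<epsilon>: "\<epsilon> > 0" using b by (simp add: \<epsilon>_def)
  define C where "C = 2 / cmod (b - 1) + (cmod b + 1) * (1 + 2 / Re b)"
  let ?V = "{q. Re (fst q + snd q) > 2 + \<epsilon>} \<inter> {q. Re (snd q) > Re b / 2} \<inter>
    {q. cmod (snd q - 1) > cmod (b - 1) / 2} \<inter> {q :: complex \<times> complex. cmod (snd q) < cmod b + 1}"
  let ?M = "\<lambda>m. C * real (1 + m) powr (- 1 - \<epsilon>)"
  have "open ?V"
    by (intro open_Int open_Collect_less continuous_intros)
  moreover have "p \<in> ?V"
    using b \<epsilon> by (auto simp: ab \<epsilon>_def field_simps)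
  moreover have "summable ?M"
    using powr_tail_sum(1)[OF \<epsilon>, of 1] by (intro summable_mult) auto
  moreover have "cmod (1 / of_nat (Suc m) powr fst q * zeta_tail (Suc m) (snd q)) \<le> ?M m"
    if q: "q \<in> ?V" for m q
  proof -
    obtain s1 s2 where s: "q = (s1, s2)" by (cases q)
    have q': "Re (s1 + s2) > 2 + \<epsilon>" "Re s2 > Re b / 2" "cmod (s2 - 1) > cmod (b - 1) / 2" "cmod s2 < cmod b + 1"
      using q by (auto simp: s)
    have s2: "Re s2 > 0" "s2 \<noteq> 1" using q' b by auto
    have "1 / cmod (s2 - 1) \<le> 1 / (cmod (b - 1) / 2)"
      using q'(3) b by (intro divide_left_mono mult_pos_pos) auto
    moreover have "1 / Re s2 \<le> 1 / (Re b / 2)"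
      using q'(2) b s2 by (intro divide_left_mono mult_pos_pos) auto
    then have "cmod s2 * (1 + 1 / Re s2) \<le> (cmod b + 1) * (1 + 2 / Re b)"
      using q' s2 b by (intro mult_mono) auto
    ultimately have C: "1 / cmod (s2 - 1) + cmod s2 * (1 + 1 / Re s2) \<le> C"
      by (simp add: C_def)
    have C0: "0 \<le> C" using b by (simp add: C_def)
    have "cmod (1 / of_nat (Suc m) powr s1 * zeta_tail (Suc m) s2) \<le>
        (1 / cmod (s2 - 1) + cmod s2 * (1 + 1 / Re s2)) * real (Suc m) powr (1 - Re (s1 + s2))"
      using s2 by (rule norm_double_zeta_ext_term_le)
    also have "\<dots> \<le> C * real (Suc m) powr (- 1 - \<epsilon>)"
      using C C0 q' by (intro mult_mono powr_mono) auto
    finally show ?thesis by (simp add: s)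
  qed
  ultimately show ?thesis by blast
qed

lemma double_zeta_continuation_ext: "double_zeta_continuation double_zeta_dom double_zeta_ext"
  unfolding double_zeta_continuation_def
proof (intro conjI)
  have eq: "double_zeta_dom = {p. 0 < Re (snd p)} \<inter> {p. 2 < Re (fst p + snd p)}"
    by (auto simp: double_zeta_dom_def)
  show "open double_zeta_dom"
    unfolding eq by (intro open_Int open_Collect_less continuous_intros)
  show "convex double_zeta_dom"
  proof (rule convexI)
    fix p q :: "complex \<times> complex" and u v :: real
    assume pq: "p \<in> double_zeta_dom" "q \<in> double_zeta_dom" and uv: "0 \<le> u" "0 \<le> v" "u + v = 1"
    have conv: "c < u * x + v * y" if "c < x" "c < y" for c x y :: real
      using convexD[OF convex_real_interval(3)[of c], of x y u v] that uv by simp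
    show "u *\<^sub>R p + v *\<^sub>R q \<in> double_zeta_dom"
      using conv[of 0 "Re (snd p)" "Re (snd q)"] conv[of 2 "Re (fst p + snd p)" "Re (fst q + snd q)"] pq
      by (simp add: double_zeta_dom_def algebra_simps)
  qed
  show "double_zeta_halfspace \<subseteq> double_zeta_dom"
    by (auto simp: double_zeta_halfspace_def double_zeta_dom_def)
  let ?U = "double_zeta_dom - double_zeta_sing"
  have opU: "open ?U"
  proof -
    have "?U = {p. 0 < Re (snd p)} \<inter> {p. 2 < Re (fst p + snd p)} \<inter> {p. snd p \<noteq> 1}"
      unfolding double_zeta_dom_diff_sing by auto
    also have "open \<dots>"
      by (intro open_Int open_Collect_less open_Collect_neq continuous_intros)
    finally show ?thesis .
  qed
  show "holomorphic2_on double_zeta_ext ?U"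
    unfolding holomorphic2_on_def
  proof (intro conjI allI opU)
    let ?t = "\<lambda>m p. 1 / of_nat (Suc m) powr fst p * zeta_tail (Suc m) (snd p)"
    have "continuous_on ?U (\<lambda>p. \<Sum>m. ?t m p)"
    proof (rule locally_normal_series_continuous_on[OF opU])
      fix m
      have "continuous_on ({s. Re s > 0} - {1}) (zeta_tail (Suc m))"
        by (intro holomorphic_on_imp_continuous_on zeta_tail_holomorphic_on) simp
      then have "continuous_on ?U (\<lambda>p. zeta_tail (Suc m) (snd p))"
        by (rule continuous_on_compose2) (auto simp: double_zeta_dom_diff_sing intro!: continuous_intros)
      moreover have "continuous_on ?U (\<lambda>p. of_nat (Suc m) powr fst p)"
        by (intro continuous_on_powr_complex continuous_intros) (auto simp: powr_eq_0_iff simp del: of_nat_Suc)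
      ultimately show "continuous_on ?U (?t m)"
        by (intro continuous_intros) (auto simp: powr_eq_0_iff simp del: of_nat_Suc)
    next
      fix p assume "p \<in> ?U"
      from double_zeta_ext_locally_normal[OF this]
      show "\<exists>V M. open V \<and> p \<in> V \<and> summable M \<and> (\<forall>n. \<forall>y\<in>V \<inter> ?U. cmod (?t n y) \<le> M n)"
        by blast
    qed
    then show "continuous_on ?U (\<lambda>(s1, s2). double_zeta_ext s1 s2)"
      by (simp add: double_zeta_ext_def case_prod_unfold)
    show "(\<lambda>s2. double_zeta_ext s1 s2) holomorphic_on {s2. (s1, s2) \<in> ?U}" (is "_ holomorphic_on ?S") for s1
      unfolding double_zeta_ext_def
    proof (rule locally_normal_series_holomorphic_on)
      have "?S = Pair s1 -` ?U" by auto
      then show "open ?S" by (simp only:) (intro open_vimage opU continuous_intros)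
      show "(\<lambda>s2. 1 / of_nat (Suc m) powr s1 * zeta_tail (Suc m) s2) holomorphic_on ?S" for m
        by (intro holomorphic_intros holomorphic_on_subset[OF zeta_tail_holomorphic_on])
          (auto simp: double_zeta_dom_diff_sing)
      fix s2 assume "s2 \<in> ?S"
      then obtain V M where V: "open V" "(s1, s2) \<in> V" "summable M" "\<And>m q. q \<in> V \<Longrightarrow> cmod (?t m q) \<le> M m"
        using double_zeta_ext_locally_normal[of "(s1, s2)"] by blast
      have "open (Pair s1 -` V)" by (intro open_vimage V continuous_intros)
      moreover have "s2 \<in> Pair s1 -` V" using V by simp
      moreover have "\<forall>m. \<forall>y\<in>Pair s1 -` V \<inter> ?S. cmod (1 / of_nat (Suc m) powr s1 * zeta_tail (Suc m) y) \<le> M m"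
        using V(4)[of "(s1, _)"] by auto
      ultimately show "\<exists>V M. open V \<and> s2 \<in> V \<and> summable M \<and>
          (\<forall>m. \<forall>y\<in>V \<inter> ?S. cmod (1 / of_nat (Suc m) powr s1 * zeta_tail (Suc m) y) \<le> M m)"
        using V(3) by blast
    qed
    show "(\<lambda>s1. double_zeta_ext s1 s2) holomorphic_on {s1. (s1, s2) \<in> ?U}" (is "_ holomorphic_on ?S") for s2
      unfolding double_zeta_ext_def
    proof (rule locally_normal_series_holomorphic_on)
      have "?S = (\<lambda>s1. (s1, s2)) -` ?U" by auto
      then show "open ?S" by (simp only:) (intro open_vimage opU continuous_intros)
      show "(\<lambda>s1. 1 / of_nat (Suc m) powr s1 * zeta_tail (Suc m) s2) holomorphic_on ?S" for m
        by (intro holomorphic_intros) (auto simp: powr_eq_0_iff simp del: of_nat_Suc)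
      fix s1 assume "s1 \<in> ?S"
      then obtain V M where V: "open V" "(s1, s2) \<in> V" "summable M" "\<And>m q. q \<in> V \<Longrightarrow> cmod (?t m q) \<le> M m"
        using double_zeta_ext_locally_normal[of "(s1, s2)"] by blast
      have "open ((\<lambda>s1. (s1, s2)) -` V)" by (intro open_vimage V continuous_intros)
      moreover have "s1 \<in> (\<lambda>s1. (s1, s2)) -` V" using V by simp
      moreover have "\<forall>m. \<forall>y\<in>(\<lambda>s1. (s1, s2)) -` V \<inter> ?S. cmod (1 / of_nat (Suc m) powr y * zeta_tail (Suc m) s2) \<le> M m"
        using V(4)[of "(_, s2)"] by auto
      ultimately show "\<exists>V M. open V \<and> s1 \<in> V \<and> summable M \<and>
          (\<forall>m. \<forall>y\<in>V \<inter> ?S. cmod (1 / of_nat (Suc m) powr y * zeta_tail (Suc m) s2) \<le> M m)"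
        using V(3) by blast
    qed
  qed
  show "\<forall>(s1, s2)\<in>double_zeta_halfspace. double_zeta_ext s1 s2 = double_zeta_series s1 s2"
  proof clarify
    fix s1 s2 assume "(s1, s2) \<in> double_zeta_halfspace"
    then have "Re s2 > 1" by (simp add: double_zeta_halfspace_def)
    then have "zeta_tail (Suc m) s2 = (\<Sum>n. 1 / of_nat (Suc m + Suc n) powr s2)" for m
      using zeta_tail_sums[of "Suc m" s2] by (simp add: sums_iff powr_minus_divide)
    then show "double_zeta_ext s1 s2 = double_zeta_series s1 s2"
      by (simp add: double_zeta_ext_def double_zeta_series_def)
  qed
qed

lemma euler_double_zeta_eq_ext:
  assumes "Re s2 > 0" "Re (s1 + s2) > 2" "s2 \<noteq> 1"
  shows "euler_double_zeta s1 s2 = double_zeta_ext s1 s2"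
  using assms by (intro euler_double_zeta_eqI[OF double_zeta_continuation_ext])
    (simp add: double_zeta_dom_diff_sing)

subsection \<open>Mean squares of Dirichlet polynomials\<close>

lemma has_integral_exp_ii:
  fixes X Y d :: real
  assumes "X \<le> Y" "d \<noteq> 0"
  shows "((\<lambda>t. exp (\<i> * of_real (d * t))) has_integral
    (exp (\<i> * of_real (d * Y)) / (\<i> * of_real d) - exp (\<i> * of_real (d * X)) / (\<i> * of_real d))) {X..Y}"
proof (rule fundamental_theorem_of_calculus[OF assms(1)])
  fix t
  define c where "c = \<i> * of_real d"
  have c: "c \<noteq> 0" using assms by (simp add: c_def)
  have "((\<lambda>z. exp (c * z) / c) has_field_derivative exp (c * of_real t)) (at (of_real t))"
    using c by (auto intro!: derivative_eq_intros)
  then have "((\<lambda>t. exp (c * of_real t) / c) has_vector_derivative exp (c * of_real t)) (at t within {X..Y})"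
    by (rule has_vector_derivative_real_field)
  then show "((\<lambda>t. exp (\<i> * of_real (d * t)) / (\<i> * of_real d)) has_vector_derivative
      exp (\<i> * of_real (d * t))) (at t within {X..Y})" by (simp add: c_def mult.assoc)
qed

text \<open>After squaring out, a frequency gap d integrates to at most 2 / |d| wherever the
  interval lies. Absolute values are summed with no use of cancellation between different pairs;
  this is where the logarithm in the error comes from.\<close>

lemma mean_square_exponential_sum:
  fixes c :: "'a \<Rightarrow> complex" and \<omega> :: "'a \<Rightarrow> real"
  assumes "finite A" "inj_on \<omega> A" "X \<le> Y"
  shows "\<bar>integral {X..Y} (\<lambda>t. (cmod (\<Sum>n\<in>A. c n * exp (- \<i> * of_real (\<omega> n * t))))\<^sup>2) -
      (Y - X) * (\<Sum>n\<in>A. (cmod (c n))\<^sup>2)\<bar> \<le>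
    (\<Sum>m\<in>A. \<Sum>n\<in>A - {m}. cmod (c m) * cmod (c n) * (2 / \<bar>\<omega> n - \<omega> m\<bar>))"
proof -
  define P where "P t = (\<Sum>n\<in>A. c n * exp (- \<i> * of_real (\<omega> n * t)))" for t
  \<comment> \<open>Off the diagonal \<open>J m n\<close> is the difference of the antiderivative at
    the ends; the conjugate falls on n, whence the sign of the gap.\<close>
  define J where "J m n = (if m = n then of_real (Y - X) else
     exp (\<i> * of_real ((\<omega> n - \<omega> m) * Y)) / (\<i> * of_real (\<omega> n - \<omega> m)) -
     exp (\<i> * of_real ((\<omega> n - \<omega> m) * X)) / (\<i> * of_real (\<omega> n - \<omega> m)))" for m n
  have P2: "of_real ((cmod (P t))\<^sup>2) =
      (\<Sum>m\<in>A. \<Sum>n\<in>A. c m * cnj (c n) * exp (\<i> * of_real ((\<omega> n - \<omega> m) * t)))" for t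
  proof -
    have "of_real ((cmod (P t))\<^sup>2) = P t * cnj (P t)" by (rule complex_norm_square)
    also have "\<dots> = (\<Sum>m\<in>A. \<Sum>n\<in>A. (c m * exp (- \<i> * of_real (\<omega> m * t))) * cnj (c n * exp (- \<i> * of_real (\<omega> n * t))))"
      unfolding P_def cnj_sum by (rule sum_product)
    also have "\<dots> = (\<Sum>m\<in>A. \<Sum>n\<in>A. c m * cnj (c n) * exp (\<i> * of_real ((\<omega> n - \<omega> m) * t)))"
    proof (intro sum.cong refl)
      fix m n
      have "exp (- \<i> * of_real (\<omega> m * t)) * cnj (exp (- \<i> * of_real (\<omega> n * t))) = exp (\<i> * of_real ((\<omega> n - \<omega> m) * t))"
        by (simp add: exp_cnj algebra_simps flip: exp_add)
      then show "(c m * exp (- \<i> * of_real (\<omega> m * t))) * cnj (c n * exp (- \<i> * of_real (\<omega> n * t))) =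
          c m * cnj (c n) * exp (\<i> * of_real ((\<omega> n - \<omega> m) * t))"
        by (simp add: algebra_simps)
    qed
    finally show ?thesis .
  qed
  have J: "((\<lambda>t. exp (\<i> * of_real ((\<omega> n - \<omega> m) * t))) has_integral J m n) {X..Y}" if "m \<in> A" "n \<in> A" for m n
  proof (cases "m = n")
    case True
    then show ?thesis using has_integral_const_real[of "1::complex" X Y] assms
      by (simp add: J_def scaleR_conv_of_real)
  next
    case False
    then have "\<omega> n - \<omega> m \<noteq> 0" using assms(2) that by (auto simp: inj_on_def)
    from has_integral_exp_ii[OF assms(3) this] False show ?thesis by (simp add: J_def)
  qed
  have "((\<lambda>t. of_real ((cmod (P t))\<^sup>2)) has_integral (\<Sum>m\<in>A. \<Sum>n\<in>A. c m * cnj (c n) * J m n)) {X..Y}"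
    unfolding P2 by (intro has_integral_sum assms has_integral_mult_right J)
  moreover have "continuous_on {X..Y} (\<lambda>t. (cmod (P t))\<^sup>2)"
    unfolding P_def by (intro continuous_intros)
  then have "((\<lambda>t. (cmod (P t))\<^sup>2) has_integral integral {X..Y} (\<lambda>t. (cmod (P t))\<^sup>2)) {X..Y}"
    by (intro integrable_integral integrable_continuous_real)
  then have "((\<lambda>t. complex_of_real ((cmod (P t))\<^sup>2)) has_integral of_real (integral {X..Y} (\<lambda>t. (cmod (P t))\<^sup>2))) {X..Y}"
    by (rule has_integral_of_real)
  ultimately have I: "of_real (integral {X..Y} (\<lambda>t. (cmod (P t))\<^sup>2)) = (\<Sum>m\<in>A. \<Sum>n\<in>A. c m * cnj (c n) * J m n)"
    using has_integral_unique by blast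
  also have "\<dots> = (\<Sum>m\<in>A. c m * cnj (c m) * J m m + (\<Sum>n\<in>A - {m}. c m * cnj (c n) * J m n))"
    by (intro sum.cong refl sum.remove assms)
  also have "\<dots> = of_real ((Y - X) * (\<Sum>n\<in>A. (cmod (c n))\<^sup>2)) + (\<Sum>m\<in>A. \<Sum>n\<in>A - {m}. c m * cnj (c n) * J m n)"
    by (simp add: sum.distrib J_def sum_distrib_left sum_distrib_right complex_norm_square mult.commute
        flip: of_real_power of_real_diff)
  finally have "complex_of_real (integral {X..Y} (\<lambda>t. (cmod (P t))\<^sup>2) - (Y - X) * (\<Sum>n\<in>A. (cmod (c n))\<^sup>2)) =
      (\<Sum>m\<in>A. \<Sum>n\<in>A - {m}. c m * cnj (c n) * J m n)"
    by simp
  from arg_cong[OF this, of cmod]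
  have "\<bar>integral {X..Y} (\<lambda>t. (cmod (P t))\<^sup>2) - (Y - X) * (\<Sum>n\<in>A. (cmod (c n))\<^sup>2)\<bar> =
      cmod (\<Sum>m\<in>A. \<Sum>n\<in>A - {m}. c m * cnj (c n) * J m n)"
    by (simp only: norm_of_real)
  also have "\<dots> \<le> (\<Sum>m\<in>A. \<Sum>n\<in>A - {m}. cmod (c m) * cmod (c n) * (2 / \<bar>\<omega> n - \<omega> m\<bar>))"
  proof (intro sum_norm_le)
    fix m n assume mn: "m \<in> A" "n \<in> A - {m}"
    let ?d = "\<omega> n - \<omega> m"
    have "cmod (J m n) \<le> cmod (exp (\<i> * of_real (?d * Y)) / (\<i> * of_real ?d)) + cmod (exp (\<i> * of_real (?d * X)) / (\<i> * of_real ?d))"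
    proof -
      have "J m n = exp (\<i> * of_real (?d * Y)) / (\<i> * of_real ?d) - exp (\<i> * of_real (?d * X)) / (\<i> * of_real ?d)"
        using mn unfolding J_def by (intro if_not_P) auto
      then show ?thesis by (simp only: norm_triangle_ineq4)
    qed
    also have "\<dots> = 2 / \<bar>?d\<bar>"
      by (simp only: norm_divide norm_mult norm_of_real norm_exp_i_times norm_ii)
    finally show "cmod (c m * cnj (c n) * J m n) \<le> cmod (c m) * cmod (c n) * (2 / \<bar>?d\<bar>)"
      unfolding norm_mult complex_mod_cnj by (intro mult_left_mono) auto
  qed
  finally show ?thesis by (simp add: P_def)
qed

text \<open>Two harmonic sums, one on each side of m.\<close>

lemma sum_inverse_dist_le:
  assumes "m \<in> {1..N}"
  shows "(\<Sum>n\<in>{1..N} - {m}. 1 / \<bar>real n - real m\<bar>) \<le> 2 * (1 + ln (real N))"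
proof -
  have N: "N > 0" using assms by auto
  have h: "(\<Sum>k\<in>K. 1 / real k) \<le> 1 + ln (real N)" if "K \<subseteq> {1..N}" for K
  proof -
    have "(\<Sum>k\<in>K. 1 / real k) \<le> (\<Sum>k = 1..N. 1 / real k)"
      using that by (intro sum_mono2) auto
    then show ?thesis using sum_inverse_le_ln[OF N] by simp
  qed
  have S: "{1..N} - {m} = {1..<m} \<union> {Suc m..N}" using assms by auto
  have "(\<Sum>n\<in>{1..N} - {m}. 1 / \<bar>real n - real m\<bar>) =
      (\<Sum>n\<in>{1..<m}. 1 / \<bar>real n - real m\<bar>) + (\<Sum>n\<in>{Suc m..N}. 1 / \<bar>real n - real m\<bar>)"
    unfolding S by (rule sum.union_disjoint) auto
  also have "(\<Sum>n\<in>{1..<m}. 1 / \<bar>real n - real m\<bar>) = (\<Sum>k\<in>{1..<m}. 1 / real k)"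
    by (rule sum.reindex_bij_witness[of _ "\<lambda>k. m - k" "\<lambda>k. m - k"]) auto
  also have "(\<Sum>n\<in>{Suc m..N}. 1 / \<bar>real n - real m\<bar>) = (\<Sum>k\<in>{1..N - m}. 1 / real k)"
    by (rule sum.reindex_bij_witness[of _ "\<lambda>k. k + m" "\<lambda>k. k - m"]) (use assms in auto)
  also have "(\<Sum>k\<in>{1..<m}. 1 / real k) \<le> 1 + ln (real N)" using assms by (intro h) auto
  also have "(\<Sum>k\<in>{1..N - m}. 1 / real k) \<le> 1 + ln (real N)" by (intro h) auto
  finally show ?thesis by simp
qed

lemma inverse_abs_ln_diff_le:
  fixes x y :: real
  assumes "0 < x" "0 < y" "x \<noteq> y"
  shows "1 / \<bar>ln y - ln x\<bar> \<le> max x y / \<bar>y - x\<bar>"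
proof -
  have *: "1 / \<bar>ln y - ln x\<bar> \<le> y / \<bar>y - x\<bar>" if "0 < x" "x < y" for x y :: real
  proof -
    have "ln (x / y) \<le> x / y - 1" using that by (intro ln_le_minus_one) auto
    then have l: "(y - x) / y \<le> ln y - ln x" using that by (simp add: ln_div field_simps)
    moreover have "0 < (y - x) / y" using that by simp
    ultimately have "1 / (ln y - ln x) \<le> 1 / ((y - x) / y)"
      by (intro divide_left_mono mult_pos_pos) auto
    then show ?thesis using l \<open>0 < (y - x) / y\<close> that by simp
  qed
  show ?thesis
  proof (cases "x < y")
    case True
    then show ?thesis using *[of x y] assms by (simp add: max_def)
  next
    case False
    then show ?thesis using *[of y x] assms by (simp add: max_def abs_minus_commute)
  qed
qed

text \<open>The larger of m, n, brought in by 1 / |ln n - ln m|, absorbs its own factor powr (-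
  \<sigma>) and is then at most N powr (1 - \<sigma>). One power is left, with 1 / |n - m|; summing
  over the distance gives the logarithm and over the other index a second N powr (1 - \<sigma>) / (1
  - \<sigma>). The 8 collects three factors 2: the oscillatory integral, the symmetrization in m and
  n, and the two sides of m.\<close>

lemma mean_square_dirichlet_polynomial:
  fixes c :: "nat \<Rightarrow> complex" and \<sigma> B X Y :: real
  assumes \<sigma>: "0 \<le> \<sigma>" "\<sigma> < 1" and B: "\<And>n. n \<in> {1..N} \<Longrightarrow> cmod (c n) \<le> B * real n powr (- \<sigma>)"
    and N: "N > 0" and XY: "X \<le> Y"
  shows "\<bar>integral {X..Y} (\<lambda>t. (cmod (\<Sum>n = 1..N. c n * exp (- \<i> * of_real (ln (real n) * t))))\<^sup>2) -
      (Y - X) * (\<Sum>n = 1..N. (cmod (c n))\<^sup>2)\<bar> \<le>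
    8 * B\<^sup>2 / (1 - \<sigma>) * real N powr (2 - 2 * \<sigma>) * (1 + ln (real N))"
proof -
  let ?A = "{1..N}"
  define L where "L = 1 + ln (real N)"
  have L: "L \<ge> 0" using N by (simp add: L_def)
  have B0: "B \<ge> 0"
    using order_trans[OF norm_ge_zero B[of 1]] N by simp
  define H where "H m n = real m powr (- \<sigma>) * (1 / \<bar>real n - real m\<bar>)" for m n :: nat
  have swap: "(\<Sum>m\<in>?A. \<Sum>n\<in>?A - {m}. H n m) = (\<Sum>m\<in>?A. \<Sum>n\<in>?A - {m}. H m n)"
  proof -
    have e: "?A - {m} = {n \<in> ?A. m \<noteq> n}" "?A - {m} = {n \<in> ?A. n \<noteq> m}" for m by auto
    have "(\<Sum>m\<in>?A. \<Sum>n\<in>{n \<in> ?A. m \<noteq> n}. H n m) = (\<Sum>n\<in>?A. \<Sum>m\<in>{m \<in> ?A. m \<noteq> n}. H n m)"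
      by (rule sum.swap_restrict) auto
    then show ?thesis by (simp only: flip: e)
  qed
  have "(\<Sum>m\<in>?A. \<Sum>n\<in>?A - {m}. H m n) \<le> (\<Sum>m\<in>?A. real m powr (- \<sigma>) * (2 * L))"
  proof (intro sum_mono)
    fix m assume "m \<in> ?A"
    from sum_inverse_dist_le[OF this] show "(\<Sum>n\<in>?A - {m}. H m n) \<le> real m powr (- \<sigma>) * (2 * L)"
      unfolding H_def sum_distrib_left[symmetric] L_def by (intro mult_left_mono) auto
  qed
  also have "\<dots> = (\<Sum>m = 1..N. real m powr (- \<sigma>)) * (2 * L)"
    by (simp only: sum_distrib_right)
  also have "\<dots> \<le> real N powr (1 - \<sigma>) / (1 - \<sigma>) * (2 * L)"
    using L by (intro mult_right_mono sum_powr_le \<sigma>) auto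
  finally have "(\<Sum>m\<in>?A. \<Sum>n\<in>?A - {m}. H m n) \<le> real N powr (1 - \<sigma>) / (1 - \<sigma>) * (2 * L)" .
  then have SH: "(\<Sum>m\<in>?A. \<Sum>n\<in>?A - {m}. H m n + H n m) \<le> 2 * (real N powr (1 - \<sigma>) / (1 - \<sigma>) * (2 * L))"
    unfolding sum.distrib swap by linarith
  have "inj_on (\<lambda>n. ln (real n)) ?A" by (auto simp: inj_on_def)
  then have "\<bar>integral {X..Y} (\<lambda>t. (cmod (\<Sum>n = 1..N. c n * exp (- \<i> * of_real (ln (real n) * t))))\<^sup>2) -
      (Y - X) * (\<Sum>n = 1..N. (cmod (c n))\<^sup>2)\<bar> \<le>
      (\<Sum>m\<in>?A. \<Sum>n\<in>?A - {m}. cmod (c m) * cmod (c n) * (2 / \<bar>ln (real n) - ln (real m)\<bar>))"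
    by (intro mean_square_exponential_sum XY) auto
  also have "\<dots> \<le> (\<Sum>m\<in>?A. \<Sum>n\<in>?A - {m}. 2 * B\<^sup>2 * real N powr (1 - \<sigma>) * (H m n + H n m))"
  proof (intro sum_mono)
    fix m n assume mn: "m \<in> ?A" "n \<in> ?A - {m}"
    have pos: "real m > 0" "real n > 0" "real m \<noteq> real n" using mn by auto
    let ?M = "max (real m) (real n)" and ?x = "real m powr (- \<sigma>)" and ?y = "real n powr (- \<sigma>)"
    have "?x * ?y * ?M \<le> real N powr (1 - \<sigma>) * (?x + ?y)"
    proof -
      have *: "u powr (- \<sigma>) * v powr (- \<sigma>) * v \<le> real N powr (1 - \<sigma>) * (u powr (- \<sigma>) + v powr (- \<sigma>))"
        if "0 < u" "0 < v" "v \<le> real N" for u v :: real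
      proof -
        have "u powr (- \<sigma>) * v powr (- \<sigma>) * v = v powr (1 - \<sigma>) * u powr (- \<sigma>)"
          using that by (simp add: powr_diff powr_minus field_simps)
        also have "\<dots> \<le> real N powr (1 - \<sigma>) * (u powr (- \<sigma>) + v powr (- \<sigma>))"
          using that \<sigma> by (intro mult_mono powr_mono2) auto
        finally show ?thesis .
      qed
      show ?thesis
      proof (cases "m \<le> n")
        case True
        then show ?thesis using *[of "real m" "real n"] pos mn by (simp add: max_def)
      next
        case False
        then show ?thesis using *[of "real n" "real m"] pos mn by (simp add: max_def mult.commute add.commute)
      qed
    qed
    then have xyM: "?x * ?y * ?M * (1 / \<bar>real n - real m\<bar>) \<le>
        real N powr (1 - \<sigma>) * (?x + ?y) * (1 / \<bar>real n - real m\<bar>)"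
      by (intro mult_right_mono) auto
    have "cmod (c m) * cmod (c n) * (2 / \<bar>ln (real n) - ln (real m)\<bar>) \<le>
        (B * ?x) * (B * ?y) * (2 * (?M / \<bar>real n - real m\<bar>))"
      using mn B0 inverse_abs_ln_diff_le[OF pos] by (intro mult_mono B mult_nonneg_nonneg) auto
    also have "\<dots> = 2 * B\<^sup>2 * (?x * ?y * ?M * (1 / \<bar>real n - real m\<bar>))"
      by (simp add: power2_eq_square)
    also have "\<dots> \<le> 2 * B\<^sup>2 * (real N powr (1 - \<sigma>) * (?x + ?y) * (1 / \<bar>real n - real m\<bar>))"
      by (intro mult_left_mono xyM) auto
    also have "\<dots> = 2 * B\<^sup>2 * real N powr (1 - \<sigma>) * (H m n + H n m)"
      by (simp add: H_def abs_minus_commute add_divide_distrib ring_distribs)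
    finally show "cmod (c m) * cmod (c n) * (2 / \<bar>ln (real n) - ln (real m)\<bar>) \<le>
        2 * B\<^sup>2 * real N powr (1 - \<sigma>) * (H m n + H n m)" .
  qed
  also have "\<dots> = 2 * B\<^sup>2 * real N powr (1 - \<sigma>) * (\<Sum>m\<in>?A. \<Sum>n\<in>?A - {m}. H m n + H n m)"
    by (simp only: sum_distrib_left)
  also have "\<dots> \<le> 2 * B\<^sup>2 * real N powr (1 - \<sigma>) * (2 * (real N powr (1 - \<sigma>) / (1 - \<sigma>) * (2 * L)))"
    by (intro mult_left_mono SH) auto
  also have "\<dots> = 8 * B\<^sup>2 / (1 - \<sigma>) * (real N powr (1 - \<sigma>) * real N powr (1 - \<sigma>)) * L"
    by simp
  also have "real N powr (1 - \<sigma>) * real N powr (1 - \<sigma>) = real N powr (2 - 2 * \<sigma>)"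
    by (simp add: powr_add[symmetric])
  finally show ?thesis by (simp only: L_def)
qed

subsection \<open>Approximation by Dirichlet polynomials\<close>

text \<open>The sum is empty for \<open>n \<le> 1\<close>, truncated subtraction included, so sums
  over n may start at 0 or 1 instead of 2.\<close>

definition dzeta_coeff :: "complex \<Rightarrow> nat \<Rightarrow> complex" where
  "dzeta_coeff s n = (\<Sum>m = 1..n - 1. 1 / of_nat m powr s)"

lemma sum_triangle_swap:
  fixes g :: "nat \<Rightarrow> nat \<Rightarrow> 'a::comm_monoid_add"
  shows "(\<Sum>m = 1..N. \<Sum>n = Suc m..N. g m n) = (\<Sum>n = 1..N. \<Sum>m = 1..n - 1. g m n)"
proof (induction N)
  case (Suc N)
  have "(\<Sum>m = 1..Suc N. \<Sum>n = Suc m..Suc N. g m n) = (\<Sum>m = 1..N. \<Sum>n = Suc m..Suc N. g m n)"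
    by simp
  also have "\<dots> = (\<Sum>m = 1..N. (\<Sum>n = Suc m..N. g m n) + g m (Suc N))"
    by (intro sum.cong refl) (simp add: add.commute)
  finally show ?case using Suc by (simp add: sum.distrib)
qed simp

lemma norm_sum_of_nat_powr_le:
  assumes "Re s > 1"
  shows "cmod (\<Sum>m = 1..N. 1 / of_nat m powr s) \<le> 1 + 1 / (Re s - 1)"
proof -
  let ?\<alpha> = "Re s - 1"
  have \<alpha>: "?\<alpha> > 0" using assms by simp
  have "cmod (\<Sum>m = 1..N. 1 / of_nat m powr s) \<le> (\<Sum>m = 1..N. real m powr (- 1 - ?\<alpha>))"
    by (intro sum_norm_le) (auto simp: norm_divide norm_inverse norm_of_nat_powr powr_minus divide_inverse)
  also have "\<dots> = (\<Sum>m<N. real (1 + m) powr (- 1 - ?\<alpha>))"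
    by (rule sum.reindex_bij_witness[of _ "\<lambda>m. m + 1" "\<lambda>m. m - 1"]) auto
  also have "\<dots> \<le> (\<Sum>m. real (1 + m) powr (- 1 - ?\<alpha>))"
    by (intro sum_le_suminf powr_tail_sum(1)[OF \<alpha>]) auto
  also have "\<dots> \<le> 1 + 1 / ?\<alpha>"
    using powr_tail_sum(2)[OF \<alpha>, of 1] by simp
  finally show ?thesis .
qed

lemma norm_dzeta_coeff_le:
  "Re s > 1 \<Longrightarrow> cmod (dzeta_coeff s n) \<le> 1 + 1 / (Re s - 1)"
  unfolding dzeta_coeff_def by (rule norm_sum_of_nat_powr_le)

text \<open>For m \<le> N each tail is cut at N: the finite parts form the polynomial, and all
  remainders are the same \<open>zeta_tail N s\<close>, weighted by a bounded sum. For m > N the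
  large-m bound applies to the tail itself, and \<open>Re s0 + \<sigma> > 2\<close> makes the sum
  over m converge.\<close>

lemma double_zeta_ext_approx:
  fixes s0 :: complex and \<sigma> :: real
  assumes s0: "Re s0 > 1" and \<sigma>: "0 < \<sigma>" "\<sigma> \<le> 1" and sum2: "Re s0 + \<sigma> > 2"
  obtains D :: real where "D \<ge> 0"
    "\<And>s N. \<lbrakk>Re s = \<sigma>; 2 \<le> cmod s; cmod s \<le> real N\<rbrakk> \<Longrightarrow>
      cmod (double_zeta_ext s0 s - (\<Sum>n = 1..N. dzeta_coeff s0 n * of_nat n powr (- s)))
        \<le> D * real N powr (1 - \<sigma>) / cmod s"
proof -
  obtain C where C: "C \<ge> 0" "\<And>s m. \<lbrakk>Re s = \<sigma>; 2 \<le> cmod s; cmod s \<le> real m\<rbrakk> \<Longrightarrow>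
       cmod (zeta_tail m s) \<le> C * real m powr (1 - \<sigma>) / cmod s"
    using norm_zeta_tail_le_large[OF \<sigma>(1)] by blast
  define B where "B = 1 + 1 / (Re s0 - 1)"
  define \<beta> where "\<beta> = Re s0 + \<sigma> - 2"
  have \<beta>: "\<beta> > 0" using sum2 by (simp add: \<beta>_def)
  have B: "B \<ge> 0" using s0 by (simp add: B_def)
  show thesis
  proof
    show "0 \<le> C * (B + (1 + 1 / \<beta>))" using C B \<beta> by (intro mult_nonneg_nonneg) auto
    fix s :: complex and N :: nat
    assume s: "Re s = \<sigma>" "2 \<le> cmod s" "cmod s \<le> real N"
    have s1: "s \<noteq> 1" "Re s > 0" "cmod s > 0" using s \<sigma> by auto
    have N: "N > 0" using s by (intro gr0I) auto
    define g where "g m = 1 / of_nat m powr s0 * zeta_tail m s" for m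
    let ?P = "\<Sum>n = 1..N. dzeta_coeff s0 n * of_nat n powr (- s)"
    let ?K = "C / cmod s"
    have K: "?K \<ge> 0" using C by simp
    have le: "cmod (g (Suc (m + N))) \<le> ?K * real (Suc N + m) powr (- 1 - \<beta>)" for m
    proof -
      let ?M = "Suc (m + N)"
      have "cmod (g ?M) = real ?M powr (- Re s0) * cmod (zeta_tail ?M s)"
        unfolding g_def norm_mult norm_divide
        by (simp add: norm_of_nat_powr powr_minus divide_inverse del: of_nat_Suc)
      also have "\<dots> \<le> real ?M powr (- Re s0) * (C * real ?M powr (1 - \<sigma>) / cmod s)"
        using s by (intro mult_left_mono C) auto
      also have "\<dots> = ?K * (real ?M powr (- Re s0) * real ?M powr (1 - \<sigma>))"
        by simp
      also have "real ?M powr (- Re s0) * real ?M powr (1 - \<sigma>) = real ?M powr (- 1 - \<beta>)"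
        by (simp add: powr_add[symmetric] \<beta>_def algebra_simps del: of_nat_Suc)
      finally show ?thesis by (simp add: algebra_simps)
    qed
    have sumK: "summable (\<lambda>m. ?K * real (Suc N + m) powr (- 1 - \<beta>))"
      by (intro summable_mult powr_tail_sum \<beta>) simp
    have "summable (\<lambda>m. g (Suc (m + N)))"
      by (rule summable_comparison_test'[OF sumK, of 0]) (use le in simp)
    then have sg: "summable (\<lambda>m. g (Suc m))"
      using summable_iff_shift[of "\<lambda>m. g (Suc m)" N] by simp
    have "double_zeta_ext s0 s = (\<Sum>m. g (Suc m))"
      by (simp add: double_zeta_ext_def g_def)
    also have "\<dots> = (\<Sum>m. g (Suc (m + N))) + (\<Sum>m<N. g (Suc m))"
      using suminf_split_initial_segment[OF sg, of N] by simp
    also have "(\<Sum>m<N. g (Suc m)) = (\<Sum>m = 1..N. g m)"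
      by (rule sum.reindex_bij_witness[of _ "\<lambda>m. m - 1" "\<lambda>m. m + 1"]) auto
    also have "\<dots> = (\<Sum>m = 1..N. (\<Sum>n = Suc m..N. 1 / of_nat m powr s0 * of_nat n powr (- s)) +
        1 / of_nat m powr s0 * zeta_tail N s)"
    proof (intro sum.cong refl)
      fix m assume m: "m \<in> {1..N}"
      have "zeta_tail m s = (\<Sum>n = Suc m..N. of_nat n powr (- s)) + zeta_tail N s"
        using m s1 by (intro zeta_tail_split) auto
      then show "g m = (\<Sum>n = Suc m..N. 1 / of_nat m powr s0 * of_nat n powr (- s)) + 1 / of_nat m powr s0 * zeta_tail N s"
        unfolding g_def by (simp only: distrib_left sum_distrib_left)
    qed
    also have "\<dots> = ?P + (\<Sum>m = 1..N. 1 / of_nat m powr s0) * zeta_tail N s"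
      unfolding sum.distrib sum_triangle_swap dzeta_coeff_def
      by (simp only: sum_distrib_right)
    finally have eq: "double_zeta_ext s0 s - ?P =
        (\<Sum>m = 1..N. 1 / of_nat m powr s0) * zeta_tail N s + (\<Sum>m. g (Suc (m + N)))"
      by simp
    have N1: "1 \<le> real N powr (1 - \<sigma>)" using N \<sigma> by (intro ge_one_powr_ge_zero) auto
    have "cmod ((\<Sum>m = 1..N. 1 / of_nat m powr s0) * zeta_tail N s) \<le> B * (C * real N powr (1 - \<sigma>) / cmod s)"
      unfolding norm_mult B_def using s s0
      by (intro mult_mono norm_sum_of_nat_powr_le C) auto
    moreover have "cmod (\<Sum>m. g (Suc (m + N))) \<le> ?K * (1 + 1 / \<beta>) * real N powr (1 - \<sigma>)"
    proof -
      have "cmod (\<Sum>m. g (Suc (m + N))) \<le> (\<Sum>m. ?K * real (Suc N + m) powr (- 1 - \<beta>))"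
        by (intro norm_suminf_le le sumK)
      also have "\<dots> = ?K * (\<Sum>m. real (Suc N + m) powr (- 1 - \<beta>))"
        by (intro suminf_mult powr_tail_sum \<beta>) simp
      also have "\<dots> \<le> ?K * ((1 + 1 / \<beta>) * real (Suc N) powr (- \<beta>))"
        by (intro mult_left_mono K powr_tail_sum \<beta>) simp
      also have "\<dots> \<le> ?K * ((1 + 1 / \<beta>) * real N powr (1 - \<sigma>))"
      proof (intro mult_left_mono K)
        \<comment> \<open>The decay is thrown away to match the shape of the other remainder, which
          does not decay since \<sigma> \<le> 1.\<close>
        have "real (Suc N) powr (- \<beta>) \<le> real (Suc N) powr 0"
          using \<beta> by (intro powr_mono) auto
        also have "\<dots> = 1" by simp
        finally show "real (Suc N) powr (- \<beta>) \<le> real N powr (1 - \<sigma>)" using N1 by linarith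
      qed (use \<beta> in simp)
      finally show ?thesis by (simp only: mult.assoc)
    qed
    ultimately have "cmod (double_zeta_ext s0 s - ?P) \<le>
        B * (C * real N powr (1 - \<sigma>) / cmod s) + ?K * (1 + 1 / \<beta>) * real N powr (1 - \<sigma>)"
      unfolding eq by (intro norm_triangle_le add_mono)
    also have "\<dots> = C * (B + (1 + 1 / \<beta>)) * real N powr (1 - \<sigma>) / cmod s"
      by (simp add: algebra_simps add_divide_distrib)
    finally show "cmod (double_zeta_ext s0 s - ?P) \<le> C * (B + (1 + 1 / \<beta>)) * real N powr (1 - \<sigma>) / cmod s" .
  qed
qed

subsection \<open>The diagonal series\<close>

definition dzeta_diag :: "complex \<Rightarrow> real \<Rightarrow> nat \<Rightarrow> real" where
  "dzeta_diag s \<sigma> n = (cmod (dzeta_coeff s n))\<^sup>2 * real n powr (- 2 * \<sigma>)"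

text \<open>The coefficients are bounded, so the tail compares with that of n powr (- 2 \<sigma>).
  Multiplied by T with N ~ T, it stays within T powr (2 - 2 \<sigma>), the size allowed for the
  off-diagonal terms.\<close>

lemma dzeta_diag_tail:
  fixes s :: complex and \<sigma> :: real
  assumes s: "Re s > 1" and \<sigma>: "\<sigma> > 1 / 2"
  shows "summable (dzeta_diag s \<sigma>)"
    and "N > 0 \<Longrightarrow> \<bar>suminf (dzeta_diag s \<sigma>) - (\<Sum>n = 1..N. dzeta_diag s \<sigma> n)\<bar> \<le>
      (1 + 1 / (Re s - 1))\<^sup>2 * (1 + 1 / (2 * \<sigma> - 1)) * real N powr (1 - 2 * \<sigma>)"
proof -
  define B where "B = 1 + 1 / (Re s - 1)"
  define \<alpha> where "\<alpha> = 2 * \<sigma> - 1"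
  have \<alpha>: "\<alpha> > 0" using \<sigma> by (simp add: \<alpha>_def)
  have exps: "- 2 * \<sigma> = - 1 - \<alpha>" "1 - 2 * \<sigma> = - \<alpha>" by (auto simp: \<alpha>_def)
  have le: "dzeta_diag s \<sigma> n \<le> B\<^sup>2 * real n powr (- 1 - \<alpha>)" for n
    unfolding dzeta_diag_def exps B_def
    using norm_dzeta_coeff_le[OF s] by (intro mult_right_mono power_mono) auto
  have nn: "0 \<le> dzeta_diag s \<sigma> n" for n by (simp add: dzeta_diag_def)
  have sM: "summable (\<lambda>n. B\<^sup>2 * real (k + n) powr (- 1 - \<alpha>))" if "k > 0" for k
    by (intro summable_mult powr_tail_sum \<alpha> that)
  have "summable (\<lambda>n. dzeta_diag s \<sigma> (1 + n))"
    by (rule summable_comparison_test'[OF sM[of 1], of 0]) (use le[of "Suc n" for n] nn in auto)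
  then show sm: "summable (dzeta_diag s \<sigma>)"
    using summable_Suc_iff[of "dzeta_diag s \<sigma>"] by simp
  assume N: "N > 0"
  have "(\<Sum>n<Suc N. dzeta_diag s \<sigma> n) = (\<Sum>n = 1..N. dzeta_diag s \<sigma> n)"
    by (rule sum.mono_neutral_right) (auto simp: dzeta_diag_def)
  then have "suminf (dzeta_diag s \<sigma>) - (\<Sum>n = 1..N. dzeta_diag s \<sigma> n) = (\<Sum>n. dzeta_diag s \<sigma> (n + Suc N))"
    using suminf_split_initial_segment[OF sm, of "Suc N"] by simp
  moreover have "0 \<le> (\<Sum>n. dzeta_diag s \<sigma> (n + Suc N))"
    using sm by (intro suminf_nonneg nn summable_ignore_initial_segment)
  moreover have "(\<Sum>n. dzeta_diag s \<sigma> (n + Suc N)) \<le> (\<Sum>n. B\<^sup>2 * real (Suc N + n) powr (- 1 - \<alpha>))"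
  proof (intro suminf_le sM)
    show "dzeta_diag s \<sigma> (n + Suc N) \<le> B\<^sup>2 * real (Suc N + n) powr (- 1 - \<alpha>)" for n
      using le[of "n + Suc N"] by (simp add: add.commute)
    show "summable (\<lambda>n. dzeta_diag s \<sigma> (n + Suc N))" using sm by (rule summable_ignore_initial_segment)
  qed simp
  moreover have "\<dots> = B\<^sup>2 * (\<Sum>n. real (Suc N + n) powr (- 1 - \<alpha>))"
    by (intro suminf_mult powr_tail_sum \<alpha>) simp
  moreover have "\<dots> \<le> B\<^sup>2 * ((1 + 1 / \<alpha>) * real (Suc N) powr (- \<alpha>))"
    by (intro mult_left_mono powr_tail_sum \<alpha>) auto
  moreover have "\<dots> \<le> B\<^sup>2 * ((1 + 1 / \<alpha>) * real N powr (- \<alpha>))"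
    using N \<alpha> by (intro mult_left_mono powr_mono2') auto
  ultimately have "\<bar>suminf (dzeta_diag s \<sigma>) - (\<Sum>n = 1..N. dzeta_diag s \<sigma> n)\<bar> \<le> B\<^sup>2 * ((1 + 1 / \<alpha>) * real N powr (- \<alpha>))"
    by linarith
  then show "\<bar>suminf (dzeta_diag s \<sigma>) - (\<Sum>n = 1..N. dzeta_diag s \<sigma> n)\<bar> \<le>
      (1 + 1 / (Re s - 1))\<^sup>2 * (1 + 1 / (2 * \<sigma> - 1)) * real N powr (1 - 2 * \<sigma>)"
    unfolding exps(2) by (simp only: B_def \<alpha>_def mult.assoc)
qed

lemma double_zeta_sq_eq:
  assumes "Re s > 1" "\<sigma> > 1 / 2"
  shows "double_zeta_sq s (of_real (2 * \<sigma>)) = of_real (suminf (dzeta_diag s \<sigma>))"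
proof -
  have sm: "summable (dzeta_diag s \<sigma>)" using assms by (rule dzeta_diag_tail)
  have "suminf (dzeta_diag s \<sigma>) = (\<Sum>n. dzeta_diag s \<sigma> (n + 2))"
    using suminf_split_initial_segment[OF sm, of 2]
    by (simp add: numeral_2_eq_2 dzeta_diag_def dzeta_coeff_def)
  moreover have "of_real (\<Sum>n. dzeta_diag s \<sigma> (n + 2)) = (\<Sum>n. complex_of_real (dzeta_diag s \<sigma> (n + 2)))"
    using sm by (intro suminf_of_real summable_ignore_initial_segment)
  moreover have "(let k = j + 2 in of_real ((cmod (\<Sum>m = 1..k - 1. 1 / of_nat m powr s))\<^sup>2) *
      (1 / of_nat k powr of_real (2 * \<sigma>))) = complex_of_real (dzeta_diag s \<sigma> (j + 2))" for j
  proof -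
    have "complex_of_nat (j + 2) powr of_real (2 * \<sigma>) = of_real (real (j + 2) powr (2 * \<sigma>))"
      using powr_of_real[of "real (j + 2)" "2 * \<sigma>"] by simp
    then show ?thesis
      unfolding Let_def dzeta_diag_def dzeta_coeff_def
      by (simp only: powr_minus_divide mult_minus_left of_real_mult of_real_divide of_real_1)
  qed
  ultimately show ?thesis unfolding double_zeta_sq_def by simp
qed

subsection \<open>Dyadic summation\<close>

text \<open>Halving T repeatedly gives a geometric series with ratio q. The constant M is chosen so
  that K + M q \<le> M closes the induction and M g \<ge> K0 starts it. The condition q < 1 requires
  genuine power growth of G; a bare logarithm would not qualify.\<close>

lemma dyadic_bound:
  fixes J G :: "real \<Rightarrow> real" and K0 K q g :: real
  assumes base: "\<And>T. 2 \<le> T \<Longrightarrow> T \<le> 4 \<Longrightarrow> \<bar>J T\<bar> \<le> K0"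
    and step: "\<And>T. T \<ge> 4 \<Longrightarrow> \<bar>J T - J (T / 2)\<bar> \<le> K * G T"
    and half: "\<And>T. T \<ge> 4 \<Longrightarrow> G (T / 2) \<le> q * G T"
    and G: "\<And>T. T \<ge> 2 \<Longrightarrow> g \<le> G T" and pos: "0 < g" "0 \<le> K" "0 \<le> K0" "q < 1"
    and T: "T \<ge> 2"
  shows "\<bar>J T\<bar> \<le> (K0 / g + K / (1 - q)) * G T"
proof -
  define M where "M = K0 / g + K / (1 - q)"
  have M0: "M \<ge> 0" using pos by (simp add: M_def)
  have "K / (1 - q) \<le> M" using pos by (simp add: M_def)
  then have MK: "K \<le> M * (1 - q)" using pos by (simp add: pos_divide_le_eq)
  have *: "\<bar>J T\<bar> \<le> M * G T" if "2 \<le> T" "T \<le> 4 * 2 ^ n" for n T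
    using that
  proof (induction n arbitrary: T)
    case 0
    have "K0 / g * g \<le> M * G T"
      using G[of T] 0 pos M0 by (intro mult_mono) (auto simp: M_def)
    then show ?case using base[of T] 0 pos by simp
  next
    case (Suc n)
    show ?case
    proof (cases "T \<le> 4")
      case True
      moreover have "(1::real) \<le> 2 ^ n" by simp
      ultimately have "T \<le> 4 * 2 ^ n" by linarith
      then show ?thesis using Suc.IH[of T] Suc.prems by simp
    next
      case False
      have GT: "G T > 0" using G[of T] False pos by simp
      have "\<bar>J T\<bar> \<le> \<bar>J (T / 2)\<bar> + \<bar>J T - J (T / 2)\<bar>" by linarith
      also have "\<dots> \<le> M * G (T / 2) + K * G T"
        using Suc.prems False by (intro add_mono Suc.IH step) auto
      also have "\<dots> \<le> M * (q * G T) + (M * (1 - q)) * G T"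
        using half[of T] False M0 MK GT by (intro add_mono mult_left_mono mult_right_mono) auto
      also have "\<dots> = M * G T" by (simp add: algebra_simps)
      finally show ?thesis .
    qed
  qed
  obtain n where "T < 2 ^ n" using real_arch_pow[of 2 T] by auto
  then have "T \<le> 4 * 2 ^ n" using T by linarith
  then show ?thesis using *[of T n] T by (simp add: M_def)
qed

subsection \<open>Mean square over a dyadic block\<close>

text \<open>Positive t keeps the line off \<open>s2 = 1\<close>, which matters when \<sigma> =
  1.\<close>

lemma continuous_on_double_zeta_ext_line:
  assumes "\<sigma> > 0" "Re s0 + \<sigma> > 2"
  shows "continuous_on {0<..} (\<lambda>t. double_zeta_ext s0 (Complex \<sigma> t))"
proof -
  have "(\<lambda>s2. double_zeta_ext s0 s2) holomorphic_on {s2. (s0, s2) \<in> double_zeta_dom - double_zeta_sing}"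
    using double_zeta_continuation_ext
    unfolding double_zeta_continuation_def holomorphic2_on_def by blast
  then have "continuous_on {s2. (s0, s2) \<in> double_zeta_dom - double_zeta_sing} (\<lambda>s2. double_zeta_ext s0 s2)"
    by (rule holomorphic_on_imp_continuous_on)
  moreover have "continuous_on {0<..} (\<lambda>t. Complex \<sigma> t)"
    unfolding Complex_eq by (intro continuous_intros)
  ultimately show ?thesis
    by (rule continuous_on_compose2)
      (use assms in \<open>auto simp: double_zeta_dom_diff_sing complex_eq_iff\<close>)
qed

text \<open>The weight S is left free, to balance the mean square of w against r.\<close>

lemma abs_norm_square_diff_le:
  fixes z w :: complex and r S :: real
  assumes "cmod (z - w) \<le> r" "S > 0"
  shows "\<bar>(cmod z)\<^sup>2 - (cmod w)\<^sup>2\<bar> \<le> (cmod w)\<^sup>2 / S + (S + 1) * r\<^sup>2"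
proof -
  define a where "a = cmod w"
  have r: "0 \<le> r" using assms(1) norm_ge_zero order_trans by blast
  have a: "0 \<le> a" by (simp add: a_def)
  have d: "\<bar>cmod z - a\<bar> \<le> r" using norm_triangle_ineq3[of z w] assms by (simp add: a_def)
  have "\<bar>(cmod z)\<^sup>2 - a\<^sup>2\<bar> = \<bar>cmod z - a\<bar> * (cmod z + a)"
    using a by (simp add: power2_eq_square square_diff_square_factored abs_mult mult.commute)
  also have "\<dots> \<le> r * (2 * a + r)" using d r a by (intro mult_mono) auto
  also have "\<dots> = 2 * a * r + r\<^sup>2" by (simp add: power2_eq_square algebra_simps)
  also have "2 * a * r \<le> a\<^sup>2 / S + S * r\<^sup>2"
  proof -
    have "0 \<le> (a - S * r)\<^sup>2 / S" using assms by simp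
    also have "\<dots> = a\<^sup>2 / S + S * r\<^sup>2 - 2 * a * r"
      using assms by (simp add: power2_eq_square field_simps)
    finally show ?thesis by simp
  qed
  finally show ?thesis by (simp add: a_def algebra_simps)
qed

lemma double_zeta_block:
  fixes s0 :: complex and \<sigma> :: real
  assumes s0: "Re s0 > 1" and \<sigma>: "1 / 2 < \<sigma>" "\<sigma> \<le> 1" and sum2: "Re s0 + \<sigma> > 2"
    and \<tau>: "1 / 2 \<le> \<tau>" "\<tau> \<le> \<sigma>" "\<tau> < 1"
  obtains K :: real where "K \<ge> 0"
    "\<And>T. T \<ge> 4 \<Longrightarrow>
      \<bar>integral {T / 2..T} (\<lambda>t. (cmod (double_zeta_ext s0 (Complex \<sigma> t)))\<^sup>2) -
        suminf (dzeta_diag s0 \<sigma>) * (T / 2)\<bar>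
        \<le> K * (T powr (2 - 2 * \<tau>) * ln T + T powr (1 / 2))"
proof -
  have \<sigma>0: "\<sigma> > 0" using \<sigma> by simp
  obtain D where D: "D \<ge> 0"
    "\<And>s N. \<lbrakk>Re s = \<sigma>; 2 \<le> cmod s; cmod s \<le> real N\<rbrakk> \<Longrightarrow>
      cmod (double_zeta_ext s0 s - (\<Sum>n = 1..N. dzeta_coeff s0 n * of_nat n powr (- s)))
        \<le> D * real N powr (1 - \<sigma>) / cmod s"
    using double_zeta_ext_approx[OF s0 \<sigma>0 \<sigma>(2) sum2] by blast
  define B where "B = 1 + 1 / (Re s0 - 1)"
  have B: "B \<ge> 0" using s0 by (simp add: B_def)
  define A where "A = suminf (dzeta_diag s0 \<sigma>)"
  have A: "A \<ge> 0"
    unfolding A_def using dzeta_diag_tail(1)[OF s0 \<sigma>(1)] by (intro suminf_nonneg) (auto simp: dzeta_diag_def)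
  define K1 where "K1 = 8 * B\<^sup>2 / (1 - \<tau>)"
  define K2 where "K2 = B\<^sup>2 * (1 + 1 / (2 * \<sigma> - 1))"
  have K12: "K1 \<ge> 0" "K2 \<ge> 0" using \<tau> \<sigma> by (auto simp: K1_def K2_def)
  show thesis
  proof
    show "0 \<le> 2 * (9 * K1 + K2) + (A + 36 * D\<^sup>2)" using K12 A by simp
    fix T :: real assume T: "T \<ge> 4"
    \<comment> \<open>On the block |s| \<le> \<sigma> + t \<le> 1 + T \<le> 2 T, so the cutoff lies
      beyond the conductor for all t at once.\<close>
    define N where "N = nat \<lceil>2 * T\<rceil>"
    have N: "2 * T \<le> real N" "real N \<le> 3 * T" "N > 0"
      using T by (auto simp: N_def of_nat_nat) linarith+
    define V where "V = T powr (2 - 2 * \<tau>) * ln T"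
    \<comment> \<open>With r of order T powr (- 1 / 2), the integral of |P|^2 / S is about T / S and
      that of S r^2 about S; the square root of T balances them.\<close>
    define S where "S = T powr (1 / 2)"
    have SS: "S * S = T" using T by (simp add: S_def powr_add[symmetric])
    have S1: "S \<ge> 1" unfolding S_def using T by (intro ge_one_powr_ge_zero) auto
    have lnT: "ln T \<ge> 1"
      using T exp_le by (subst ln_ge_iff) auto
    define c where "c n = dzeta_coeff s0 n * of_real (real n powr (- \<sigma>))" for n
    define P where "P t = (\<Sum>n = 1..N. c n * exp (- \<i> * of_real (ln (real n) * t)))" for t
    define F where "F t = double_zeta_ext s0 (Complex \<sigma> t)" for t
    have powr3: "real N powr x \<le> 3 * T powr x" if "0 \<le> x" "x \<le> 1" for x
    proof -
      have "real N powr x \<le> (3 * T) powr x" using N that by (intro powr_mono2) auto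
      also have "\<dots> = 3 powr x * T powr x" using T by (simp add: powr_mult)
      also have "\<dots> \<le> 3 powr 1 * T powr x" using that by (intro mult_right_mono powr_mono) auto
      finally show ?thesis by simp
    qed
    have Peq: "(\<Sum>n = 1..N. dzeta_coeff s0 n * of_nat n powr (- Complex \<sigma> t)) = P t" for t
      unfolding P_def
    proof (intro sum.cong refl)
      fix n assume n: "n \<in> {1..N}"
      have "of_nat n powr (- Complex \<sigma> t) = exp (- Complex \<sigma> t * of_real (ln (real n)))"
        using n by (simp add: powr_def Ln_of_nat)
      also have "- Complex \<sigma> t * of_real (ln (real n)) = of_real (- \<sigma> * ln (real n)) + - \<i> * of_real (ln (real n) * t)"
        by (simp add: Complex_eq algebra_simps)
      also have "exp \<dots> = of_real (real n powr (- \<sigma>)) * exp (- \<i> * of_real (ln (real n) * t))"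
        using n by (simp only: exp_add exp_of_real) (simp add: powr_def)
      finally show "dzeta_coeff s0 n * of_nat n powr (- Complex \<sigma> t) = c n * exp (- \<i> * of_real (ln (real n) * t))"
        by (simp add: c_def)
    qed
    \<comment> \<open>The coefficients carry the exponent \<sigma>, but are estimated with the
      smaller \<tau>, so that the polynomial bound applies even at \<sigma> = 1.\<close>
    have cN: "cmod (c n) \<le> B * real n powr (- \<tau>)" if "n \<in> {1..N}" for n
      unfolding c_def norm_mult norm_of_real B_def using that \<tau> s0
      by (intro mult_mono norm_dzeta_coeff_le) (auto intro!: powr_mono)
    have c2: "(cmod (c n))\<^sup>2 = dzeta_diag s0 \<sigma> n" for n
      by (simp add: c_def dzeta_diag_def norm_mult power_mult_distrib power2_eq_square powr_add[symmetric])
    let ?IP = "integral {T / 2..T} (\<lambda>t. (cmod (P t))\<^sup>2)"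
    have "\<bar>?IP - (T - T / 2) * (\<Sum>n = 1..N. (cmod (c n))\<^sup>2)\<bar> \<le>
        8 * B\<^sup>2 / (1 - \<tau>) * real N powr (2 - 2 * \<tau>) * (1 + ln (real N))"
      unfolding P_def using \<tau> N T cN by (intro mean_square_dirichlet_polynomial) auto
    also have "\<dots> \<le> K1 * (3 * T powr (2 - 2 * \<tau>)) * (3 * ln T)"
    proof -
      have "ln (real N) \<le> ln (T * T)" using N T by (intro ln_mono) (auto intro: order_trans[of _ "4 * T"])
      also have "\<dots> = 2 * ln T" using T by (simp add: ln_mult)
      finally have "1 + ln (real N) \<le> 3 * ln T" using lnT by simp
      moreover have "0 \<le> 1 + ln (real N)" using N by simp
      ultimately show ?thesis
        unfolding K1_def using \<tau> by (intro mult_mono powr3) auto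
    qed
    finally have off: "\<bar>?IP - T / 2 * (\<Sum>n = 1..N. dzeta_diag s0 \<sigma> n)\<bar> \<le> 9 * K1 * V"
      by (simp add: V_def c2)
    have diag: "\<bar>T / 2 * A - T / 2 * (\<Sum>n = 1..N. dzeta_diag s0 \<sigma> n)\<bar> \<le> K2 * V"
    proof -
      have "\<bar>A - (\<Sum>n = 1..N. dzeta_diag s0 \<sigma> n)\<bar> \<le> K2 * real N powr (1 - 2 * \<sigma>)"
        using dzeta_diag_tail(2)[OF s0 \<sigma>(1) N(3)] by (simp add: A_def K2_def B_def)
      also have "\<dots> \<le> K2 * T powr (1 - 2 * \<sigma>)"
        using K12 N T \<sigma> by (intro mult_left_mono powr_mono2') auto
      finally have *: "\<bar>A - (\<Sum>n = 1..N. dzeta_diag s0 \<sigma> n)\<bar> \<le> K2 * T powr (1 - 2 * \<sigma>)" .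
      have "\<bar>T / 2 * A - T / 2 * (\<Sum>n = 1..N. dzeta_diag s0 \<sigma> n)\<bar> = T / 2 * \<bar>A - (\<Sum>n = 1..N. dzeta_diag s0 \<sigma> n)\<bar>"
        unfolding right_diff_distrib[symmetric] abs_mult using T by simp
      also have "\<dots> \<le> T * (K2 * T powr (1 - 2 * \<sigma>))"
        using * T K12 by (intro mult_mono) auto
      also have "\<dots> = K2 * T powr (2 - 2 * \<sigma>)"
      proof -
        have "T powr 1 * T powr (1 - 2 * \<sigma>) = T powr (2 - 2 * \<sigma>)" by (simp only: powr_add[symmetric]) simp
        then show ?thesis using T by simp
      qed
      also have "\<dots> \<le> K2 * (T powr (2 - 2 * \<tau>) * ln T)"
      proof (intro mult_left_mono K12)
        have "T powr (2 - 2 * \<sigma>) * 1 \<le> T powr (2 - 2 * \<tau>) * ln T"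
          using T \<tau> lnT by (intro mult_mono powr_mono) auto
        then show "T powr (2 - 2 * \<sigma>) \<le> T powr (2 - 2 * \<tau>) * ln T" by simp
      qed
      finally show ?thesis by (simp add: V_def)
    qed
    define E where "E = (9 * K1 + K2) * V"
    have E: "\<bar>?IP - A * (T / 2)\<bar> \<le> E" and E0: "0 \<le> E"
    proof -
      have "9 * K1 * V + K2 * V = E" by (simp add: E_def algebra_simps)
      moreover have "A * (T / 2) = T / 2 * A" by simp
      ultimately show "\<bar>?IP - A * (T / 2)\<bar> \<le> E" using off diag by linarith
      then show "0 \<le> E" by linarith
    qed
    \<comment> \<open>The 6 is 3 from N powr (1 - \<sigma>) \<le> 3 T powr (1 - \<sigma>), times 2
      from |s| \<ge> T / 2; then T powr (- \<sigma>) is weakened to T powr (- 1 / 2).\<close>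
    define r where "r = 6 * D / S"
    have FP: "cmod (F t - P t) \<le> r" if t: "t \<in> {T / 2..T}" for t
    proof -
      let ?s = "Complex \<sigma> t"
      have ge: "T / 2 \<le> cmod ?s" using abs_Im_le_cmod[of ?s] t by simp
      have "cmod ?s \<le> \<bar>\<sigma>\<bar> + \<bar>t\<bar>" using cmod_le[of ?s] by simp
      then have le: "cmod ?s \<le> real N" using t T \<sigma> N by simp
      have "cmod (F t - P t) \<le> D * real N powr (1 - \<sigma>) / cmod ?s"
        unfolding F_def Peq[symmetric] using ge le T by (intro D) auto
      also have "\<dots> \<le> D * (3 * T powr (1 - \<sigma>)) / (T / 2)"
        using ge T D(1) \<sigma> by (intro frac_le mult_left_mono powr3 mult_nonneg_nonneg) auto
      also have "\<dots> = 6 * D * T powr (- \<sigma>)"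
        using T by (simp add: powr_diff powr_minus field_simps)
      also have "\<dots> \<le> 6 * D * T powr (- (1 / 2))"
        using T D(1) \<sigma> by (intro mult_left_mono powr_mono) auto
      also have "\<dots> = r" by (simp only: r_def S_def powr_minus_divide) simp
      finally show ?thesis .
    qed
    have contF: "continuous_on {T / 2..T} (\<lambda>t. (cmod (F t))\<^sup>2)"
      unfolding F_def using T
      by (intro continuous_intros continuous_on_subset[OF continuous_on_double_zeta_ext_line[OF \<sigma>0 sum2]]) auto
    have contP: "continuous_on {T / 2..T} (\<lambda>t. (cmod (P t))\<^sup>2)"
      unfolding P_def by (intro continuous_intros)
    let ?IF = "integral {T / 2..T} (\<lambda>t. (cmod (F t))\<^sup>2)"
    have intF: "(\<lambda>t. (cmod (F t))\<^sup>2) integrable_on {T / 2..T}"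
      and intP: "(\<lambda>t. (cmod (P t))\<^sup>2) integrable_on {T / 2..T}"
      using contF contP by (auto intro: integrable_continuous_real)
    have "\<bar>?IF - ?IP\<bar> = norm (integral {T / 2..T} (\<lambda>t. (cmod (F t))\<^sup>2 - (cmod (P t))\<^sup>2))"
      by (simp add: Henstock_Kurzweil_Integration.integral_diff[OF intF intP])
    also have "\<dots> \<le> integral {T / 2..T} (\<lambda>t. (cmod (P t))\<^sup>2 / S + (S + 1) * r\<^sup>2)"
    proof (rule integral_norm_bound_integral)
      show "(\<lambda>t. (cmod (F t))\<^sup>2 - (cmod (P t))\<^sup>2) integrable_on {T / 2..T}"
        by (intro integrable_diff intF intP)
      show "(\<lambda>t. (cmod (P t))\<^sup>2 / S + (S + 1) * r\<^sup>2) integrable_on {T / 2..T}"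
        using S1 by (intro integrable_continuous_real continuous_intros contP) auto
      show "norm ((cmod (F t))\<^sup>2 - (cmod (P t))\<^sup>2) \<le> (cmod (P t))\<^sup>2 / S + (S + 1) * r\<^sup>2"
        if "t \<in> {T / 2..T}" for t
        using abs_norm_square_diff_le[OF FP[OF that], of S] S1 by simp
    qed
    also have "\<dots> = ?IP / S + T / 2 * ((S + 1) * r\<^sup>2)"
    proof -
      have "((\<lambda>t. (cmod (P t))\<^sup>2 / S + (S + 1) * r\<^sup>2) has_integral (?IP / S + (T - T / 2) *\<^sub>R ((S + 1) * r\<^sup>2))) {T / 2..T}"
        using T by (intro has_integral_add has_integral_divide integrable_integral intP has_integral_const_real[THEN has_integral_eq_rhs]) auto
      then show ?thesis by (simp add: integral_unique)
    qed
    also have "T / 2 * ((S + 1) * r\<^sup>2) \<le> 36 * D\<^sup>2 * S"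
    proof -
      have "r\<^sup>2 = 36 * D\<^sup>2 / T" by (simp add: r_def power_divide power_mult_distrib power2_eq_square[of S] SS)
      then have "T / 2 * ((S + 1) * r\<^sup>2) = 36 * D\<^sup>2 * ((S + 1) / 2)" using T by simp
      also have "\<dots> \<le> 36 * D\<^sup>2 * S" using S1 by (intro mult_left_mono) auto
      finally show ?thesis .
    qed
    also have "?IP / S \<le> A * S + E"
    proof -
      have "?IP \<le> A * (T / 2) + E" using E by linarith
      also have "\<dots> \<le> A * (S * S) + E * S"
        using A T E0 S1 mult_left_mono[of 1 S E] by (intro add_mono mult_left_mono) (auto simp: SS)
      finally show ?thesis using S1 by (simp add: pos_divide_le_eq algebra_simps)
    qed
    finally have "\<bar>?IF - ?IP\<bar> \<le> A * S + E + 36 * D\<^sup>2 * S" by simp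
    \<comment> \<open>\<open>E\<close> occurs twice: as the error in the mean square of
      \<open>P\<close>, and again through the cross term, where that mean square is bounded by its
      main term plus \<open>E\<close>.\<close>
    then have "\<bar>?IF - A * (T / 2)\<bar> \<le> 2 * E + (A + 36 * D\<^sup>2) * S"
      using E by (simp only: distrib_right)
    also have "\<dots> \<le> (2 * (9 * K1 + K2) + (A + 36 * D\<^sup>2)) * (V + S)"
    proof -
      have V0: "V \<ge> 0" using lnT by (simp add: V_def)
      have "0 \<le> 2 * (9 * K1 + K2) * S" "0 \<le> (A + 36 * D\<^sup>2) * V"
        using K12 A S1 V0 by (auto intro!: mult_nonneg_nonneg)
      then show ?thesis by (simp add: E_def algebra_simps)
    qed
    finally show "\<bar>integral {T / 2..T} (\<lambda>t. (cmod (double_zeta_ext s0 (Complex \<sigma> t)))\<^sup>2) -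
        suminf (dzeta_diag s0 \<sigma>) * (T / 2)\<bar> \<le>
        (2 * (9 * K1 + K2) + (A + 36 * D\<^sup>2)) * (T powr (2 - 2 * \<tau>) * ln T + T powr (1 / 2))"
      by (simp only: F_def A_def V_def S_def)
  qed
qed

section \<open>Summation of the blocks and choice of the dominant error term\<close>

theorem theorem1p2:
  fixes s0 :: complex and \<sigma> :: real
  assumes "Re s0 > 1" and "1 / 2 < \<sigma>" and "\<sigma> \<le> 1" and "Re s0 + \<sigma> > 2"
  shows "\<exists>E1 E2 :: real \<Rightarrow> real.
    E1 \<in> O[at_top](\<lambda>T. T powr (2 - 2 * \<sigma>) * ln T) \<and>
    E2 \<in> O[at_top](\<lambda>T. T powr (1 / 2)) \<and>
    (\<forall>T\<ge>2. complex_of_real (integral {2..T} (\<lambda>t. (cmod (euler_double_zeta s0 (Complex \<sigma> t)))\<^sup>2)) =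
       double_zeta_sq s0 (of_real (2 * \<sigma>)) * of_real T + of_real (E1 T) + of_real (E2 T))"
proof -
  note s0 = assms(1) and \<sigma> = assms(2,3)
  have \<sigma>0: "\<sigma> > 0" using \<sigma> by simp
  define A where "A = suminf (dzeta_diag s0 \<sigma>)"
  have A: "A \<ge> 0"
    unfolding A_def using dzeta_diag_tail(1)[OF s0 \<sigma>(1)] by (intro suminf_nonneg) (auto simp: dzeta_diag_def)
  define f where "f t = (cmod (double_zeta_ext s0 (Complex \<sigma> t)))\<^sup>2" for t
  \<comment> \<open>The integral starts at 2 while the main term is \<open>A * T\<close>; the
    constant discrepancy is covered by the base case of the dyadic induction.\<close>
  define J where "J T = integral {2..T} f - A * T" for T
  \<comment> \<open>\<open>G\<close> is the dominant error term. Replacing \<open>\<sigma>\<close> by \<open>\<tau> < 1\<close> keeps the off-diagonal constant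
      \<open>1 / (1 - \<tau>)\<close> finite even at \<open>\<sigma> = 1\<close>.\<close>
  define G where "G T = (if \<sigma> \<le> 3 / 4 then T powr (2 - 2 * \<sigma>) * ln T else T powr (1 / 2))" for T :: real
  define \<tau> where "\<tau> = min \<sigma> (9 / 10)"
  have \<tau>: "1 / 2 \<le> \<tau>" "\<tau> \<le> \<sigma>" "\<tau> < 1" using \<sigma> by (auto simp: \<tau>_def)
  obtain K where K: "K \<ge> 0" "\<And>T. T \<ge> 4 \<Longrightarrow>
      \<bar>integral {T / 2..T} (\<lambda>t. (cmod (double_zeta_ext s0 (Complex \<sigma> t)))\<^sup>2) -
        suminf (dzeta_diag s0 \<sigma>) * (T / 2)\<bar> \<le> K * (T powr (2 - 2 * \<tau>) * ln T + T powr (1 / 2))"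
    using double_zeta_block[OF s0 \<sigma> assms(4) \<tau>] by blast
  have ln1: "1 \<le> ln T" if "T \<ge> 4" for T :: real
    using that exp_le by (subst ln_ge_iff) auto
  obtain K' where K': "K' \<ge> 0" "\<And>T. T \<ge> 4 \<Longrightarrow> T powr (2 - 2 * \<tau>) * ln T + T powr (1 / 2) \<le> K' * G T"
  proof (cases "\<sigma> \<le> 3 / 4")
    case True
    have "T powr (2 - 2 * \<tau>) * ln T + T powr (1 / 2) \<le> 2 * G T" if T: "T \<ge> 4" for T
    proof -
      have "T powr (1 / 2) * 1 \<le> T powr (2 - 2 * \<sigma>) * ln T"
        using T True ln1[OF T] by (intro mult_mono powr_mono) auto
      moreover have "\<tau> = \<sigma>" using True by (simp add: \<tau>_def)
      ultimately show ?thesis using True by (simp add: G_def mult.commute)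
    qed
    then show ?thesis using that[of 2] by simp
  next
    case False
    \<comment> \<open>Positive because both \<sigma> and the cap 9 / 10 exceed 3 / 4. The exponent
      is tuned so that (2 - 2 \<tau>) + \<delta> = 1 / 2 once ln T is bounded by T powr \<delta> /
      \<delta>.\<close>
    define \<delta> where "\<delta> = 2 * \<tau> - 3 / 2"
    have \<delta>: "\<delta> > 0" using False by (auto simp: \<delta>_def \<tau>_def min_def)
    have "T powr (2 - 2 * \<tau>) * ln T + T powr (1 / 2) \<le> (1 / \<delta> + 1) * G T" if T: "T \<ge> 4" for T
    proof -
      have "T powr (2 - 2 * \<tau>) * ln T \<le> T powr (2 - 2 * \<tau>) * (T powr \<delta> / \<delta>)"
        using T \<delta> by (intro mult_left_mono ln_powr_bound) auto
      also have "\<dots> = (T powr (2 - 2 * \<tau>) * T powr \<delta>) / \<delta>" by simp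
      also have "T powr (2 - 2 * \<tau>) * T powr \<delta> = T powr (1 / 2)"
        by (simp add: powr_add[symmetric] \<delta>_def)
      finally show ?thesis using False by (simp add: G_def algebra_simps)
    qed
    then show ?thesis using that[of "1 / \<delta> + 1"] \<delta> by simp
  qed
  have cont: "continuous_on {2..T} f" for T
    unfolding f_def
    by (intro continuous_intros continuous_on_subset[OF continuous_on_double_zeta_ext_line[OF \<sigma>0 assms(4)]]) auto
  then have intf: "f integrable_on {2..T}" for T by (intro integrable_continuous_real)
  have f0: "0 \<le> f t" for t by (simp add: f_def)
  define K0 where "K0 = integral {2..4} f + 4 * A"
  have I0: "0 \<le> integral {2..T} f" for T using f0 by (intro integral_nonneg intf) auto
  \<comment> \<open>The ratio 2 powr (- 1 / 2) reflects that G has exponent at least 1 / 2 in both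
    cases; the lower bound 1 / 2 for G comes from ln 2 \<ge> 1 / 2.\<close>
  have bound: "\<bar>J T\<bar> \<le> (K0 / (1 / 2) + K * K' / (1 - 2 powr (- (1 / 2)))) * G T" if "T \<ge> 2" for T
  proof (rule dyadic_bound[where J = J and G = G and T = T])
    show "\<bar>J T\<bar> \<le> K0" if T: "2 \<le> T" "T \<le> 4" for T
    proof -
      have "integral {2..T} f \<le> integral {2..4} f"
        using T f0 by (intro integral_subset_le intf) auto
      moreover have "A * T \<le> A * 4" "0 \<le> A * T" using T A by (auto intro: mult_left_mono)
      ultimately show ?thesis using I0[of T] I0[of 4] by (simp add: J_def K0_def)
    qed
    show "\<bar>J T - J (T / 2)\<bar> \<le> K * K' * G T" if T: "T \<ge> 4" for T
    proof -
      have "integral {2..T / 2} f + integral {T / 2..T} f = integral {2..T} f"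
        using T by (intro Henstock_Kurzweil_Integration.integral_combine intf) auto
      then have "J T - J (T / 2) = integral {T / 2..T} f - A * (T / 2)"
        by (simp add: J_def)
      then have "\<bar>J T - J (T / 2)\<bar> \<le> K * (T powr (2 - 2 * \<tau>) * ln T + T powr (1 / 2))"
        using K(2)[OF T] by (simp only: f_def[abs_def] A_def)
      also have "\<dots> \<le> K * (K' * G T)" by (intro mult_left_mono K' K T)
      finally show ?thesis by (simp only: mult.assoc)
    qed
    show "G (T / 2) \<le> 2 powr (- (1 / 2)) * G T" if T: "T \<ge> 4" for T
    proof -
      have div: "(T / 2) powr b = 2 powr (- b) * T powr b" for b
        using T by (simp add: powr_divide powr_minus_divide)
      show ?thesis
      proof (cases "\<sigma> \<le> 3 / 4")
        case True
        have "2 powr (- (2 - 2 * \<sigma>)) * T powr (2 - 2 * \<sigma>) * ln (T / 2) \<le> 2 powr (- (1 / 2)) * T powr (2 - 2 * \<sigma>) * ln T"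
          using True T by (intro mult_mono powr_mono ln_mono) auto
        then show ?thesis using True by (simp only: G_def if_True div mult.assoc)
      next
        case False
        then show ?thesis by (simp only: G_def if_False div order_refl)
      qed
    qed
    show "1 / 2 \<le> G T" if T: "T \<ge> 2" for T
    proof (cases "\<sigma> \<le> 3 / 4")
      case True
      have "1 / 2 \<le> ln (2::real)" using ln_one_plus_inverse_bounds(1)[of 1] by simp
      also have "\<dots> \<le> ln T" using T by (intro ln_mono) auto
      finally have "1 * (1 / 2) \<le> T powr (2 - 2 * \<sigma>) * ln T"
        using T \<sigma> by (intro mult_mono ge_one_powr_ge_zero) auto
      then show ?thesis using True by (simp add: G_def)
    next
      case False
      have "1 \<le> T powr (1 / 2)" using T by (intro ge_one_powr_ge_zero) auto
      then show ?thesis using False by (simp add: G_def)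
    qed
    show "2 powr (- (1 / 2)) < (1::real)" by (simp add: powr_less_one)
  qed (use that K K' A I0[of 4] in \<open>auto simp: K0_def\<close>)
  have JO: "J \<in> O[at_top](G)"
  proof (rule bigoI)
    show "\<forall>\<^sub>F T in at_top. norm (J T) \<le> (K0 / (1 / 2) + K * K' / (1 - 2 powr (- (1 / 2)))) * norm (G T)"
      using eventually_ge_at_top[of "2::real"]
    proof eventually_elim
      case (elim T)
      have "0 \<le> G T" using elim by (auto simp: G_def)
      then show ?case using bound[OF elim] by simp
    qed
  qed
  \<comment> \<open>For t \<ge> 2 the argument has nonzero imaginary part, so the unspecified value
    at \<open>s2 = 1\<close> never enters the integral.\<close>
  have eq: "integral {2..T} (\<lambda>t. (cmod (euler_double_zeta s0 (Complex \<sigma> t)))\<^sup>2) = A * T + J T" for T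
  proof -
    have "integral {2..T} (\<lambda>t. (cmod (euler_double_zeta s0 (Complex \<sigma> t)))\<^sup>2) = integral {2..T} f"
      unfolding f_def using \<sigma>0 assms(4)
      by (intro integral_cong) (simp add: euler_double_zeta_eq_ext complex_eq_iff)
    then show ?thesis by (simp add: J_def)
  qed
  have sq: "double_zeta_sq s0 (of_real (2 * \<sigma>)) = of_real A"
    unfolding A_def using s0 \<sigma>(1) by (rule double_zeta_sq_eq)
  show ?thesis
  proof (cases "\<sigma> \<le> 3 / 4")
    case True
    then have "J \<in> O[at_top](\<lambda>T. T powr (2 - 2 * \<sigma>) * ln T)"
      using JO by (simp add: G_def[abs_def])
    then show ?thesis
      unfolding eq sq by (intro exI[of _ J] exI[of _ "\<lambda>_. 0"]) simp
  next
    case False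
    then have "J \<in> O[at_top](\<lambda>T. T powr (1 / 2))"
      using JO by (simp add: G_def[abs_def])
    then show ?thesis
      unfolding eq sq by (intro exI[of _ "\<lambda>_. 0"] exI[of _ J]) simp
  qed
qed

end
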